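(* Let $C$ be the conjugacy class of an odd permutation $\sigma\in\mathcal S_d$, let $i_1\neq i_2$ be elements of $I_d$, and let $\overline s_{(i_1,i_2)}\in S_C$ be an element such that (i) $\alpha(\overline s_{(i_1,i_2)})=(i_1,i_2)$; (ii) there are (distinct) $i_3,i_4\in I_d\setminus\{i_1,i_2\}$ such that $\rho((i_3,i_4))(\overline s_{(i_1,i_2)})=\overline s_{(i_1,i_2)}$. Then there is an embedding over $\mathcal S_d$ of the semigroup $S_{T_d}^{\mathcal S_d}$ in $S_C$, i.e. an injective semigroup homomorphism $\varphi:S_{T_d}^{\mathcal S_d}\to S_C$ such that $\alpha(\varphi(s))=\alpha(s)$ and $\varphi(\rho(g)(s))=\rho(g)(\varphi(s))$ for all $s\in S_{T_d}^{\mathcal S_d}$ and $g\in\mathcal S_d$.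
   Context: $\mathcal S_d$ is the symmetric group acting on $I_d=\{1,\dots,d\}$, $T_d\subset\mathcal S_d$ is the set of transpositions, and $(i,j)$ denotes the transposition exchanging $i$ and $j$. Factorization semigroups. Let $G$ be a group and $O\subset G$ a subset invariant under inner automorphisms. The semigroup $S_O=S(G,O)$ is generated by the alphabet $\{x_g\mid g\in O\}$ subject to the relations $x_{g_1}\cdot x_{g_2}=x_{g_2}\cdot x_{g_2^{-1}g_1g_2}=x_{g_1g_2g_1^{-1}}\cdot x_{g_1}$ for all $g_1,g_2\in O$, and $x_{g_1}\cdot x_{\mathbf 1}=x_{g_1}$ (if $\mathbf 1\in O$). The product homomorphism $\alpha:S_O\to G$ is given by $\alpha(x_g)=g$. The group $G$ acts on $S_O$ (from the left) by semigroup automorphisms $\rho(g)$, where $\rho(g)(x_a)=x_{gag^{-1}}$ for $g\in G$, $a\in O$. For $s=x_{g_1}\cdots x_{g_n}\in S_O$ put $G_s=\langle g_1,\dots,g_n\rangle$; this subgroup is well defined. Here $S_C=S(\mathcal S_d,C)$ for the conjugacy class $C$, $S_{T_d}=S(\mathcal S_d,T_d)$, and $S_{T_d}^{\mathcal S_d}=\{s\in S_{T_d}\mid G_s=\mathcal S_d\}$, which is a subsemigroup invariant under $\rho$. *)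

theory Defs
  imports "HOL-Algebra.Sym_Groups" "HOL-Library.FuncSet"
begin

section \<open>Factorization semigroups\<close>

definition conj_elt :: "('a, 'b) monoid_scheme \<Rightarrow> 'a \<Rightarrow> 'a \<Rightarrow> 'a" where
  "conj_elt G g a = g \<otimes>\<^bsub>G\<^esub> a \<otimes>\<^bsub>G\<^esub> inv\<^bsub>G\<^esub> g"

definition conj_class :: "('a, 'b) monoid_scheme \<Rightarrow> 'a \<Rightarrow> 'a set" where
  "conj_class G a = (\<lambda>g. conj_elt G g a) ` carrier G"

text \<open>
  The semigroup is a semigroup presentation, not a monoid presentation: its elements are classes
  of nonempty words over the alphabet A, where the letter \<open>x\<^sub>g\<close> is represented by \<open>g\<close> itself.
  The relation below is the least congruence on the nonempty words containing the defining
  relations. If A contains the identity, the class of its letter is a unit, because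
  \<open>x\<^sub>\<one> \<cdot> x\<^sub>g = x\<^sub>g \<cdot> x\<^sub>\<one>\<close> is an instance of the first relation.
\<close>

definition fs_words :: "'a set \<Rightarrow> 'a list set" where
  "fs_words A = lists A - {[]}"

inductive fs_cong :: "('a, 'b) monoid_scheme \<Rightarrow> 'a set \<Rightarrow> 'a list \<Rightarrow> 'a list \<Rightarrow> bool"
  for G (structure) and A
where
  swap_right: "g\<^sub>1 \<in> A \<Longrightarrow> g\<^sub>2 \<in> A \<Longrightarrow> fs_cong G A [g\<^sub>1, g\<^sub>2] [g\<^sub>2, inv g\<^sub>2 \<otimes> g\<^sub>1 \<otimes> g\<^sub>2]"
| swap_left: "g\<^sub>1 \<in> A \<Longrightarrow> g\<^sub>2 \<in> A \<Longrightarrow> fs_cong G A [g\<^sub>1, g\<^sub>2] [g\<^sub>1 \<otimes> g\<^sub>2 \<otimes> inv g\<^sub>1, g\<^sub>1]"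
| unit: "g \<in> A \<Longrightarrow> \<one> \<in> A \<Longrightarrow> fs_cong G A [g, \<one>] [g]"
| refl: "w \<in> fs_words A \<Longrightarrow> fs_cong G A w w"
| sym: "fs_cong G A u v \<Longrightarrow> fs_cong G A v u"
| trans: "fs_cong G A u v \<Longrightarrow> fs_cong G A v w \<Longrightarrow> fs_cong G A u w"
| append: "fs_cong G A u u' \<Longrightarrow> fs_cong G A v v' \<Longrightarrow> fs_cong G A (u @ v) (u' @ v')"

definition fs_rel :: "('a, 'b) monoid_scheme \<Rightarrow> 'a set \<Rightarrow> ('a list \<times> 'a list) set" where
  "fs_rel G A = {(u, v). fs_cong G A u v}"

definition fact_semigroup :: "('a, 'b) monoid_scheme \<Rightarrow> 'a set \<Rightarrow> 'a list set set" where
  "fact_semigroup G A = fs_words A // fs_rel G A"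

text \<open>
  The following operations are defined on classes through representatives; that they do not
  depend on the representatives when A is invariant under conjugation is shown further below.
\<close>

definition fs_mult ::
  "('a, 'b) monoid_scheme \<Rightarrow> 'a set \<Rightarrow> 'a list set \<Rightarrow> 'a list set \<Rightarrow> 'a list set" where
  "fs_mult G A s t = (\<Union>u\<in>s. \<Union>v\<in>t. fs_rel G A `` {u @ v})"

definition fs_prod :: "('a, 'b) monoid_scheme \<Rightarrow> 'a list set \<Rightarrow> 'a" where
  "fs_prod G s = the_elem ((\<lambda>w. foldr (\<otimes>\<^bsub>G\<^esub>) w \<one>\<^bsub>G\<^esub>) ` s)"

definition fs_act ::
  "('a, 'b) monoid_scheme \<Rightarrow> 'a set \<Rightarrow> 'a \<Rightarrow> 'a list set \<Rightarrow> 'a list set" where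
  "fs_act G A g s = (\<Union>w\<in>s. fs_rel G A `` {map (conj_elt G g) w})"

definition fs_gen :: "('a, 'b) monoid_scheme \<Rightarrow> 'a list set \<Rightarrow> 'a set" where
  "fs_gen G s = the_elem ((\<lambda>w. generate G (set w)) ` s)"

definition full_fact_semigroup :: "('a, 'b) monoid_scheme \<Rightarrow> 'a set \<Rightarrow> 'a list set set" where
  "full_fact_semigroup G A = {s \<in> fact_semigroup G A. fs_gen G s = carrier G}"

definition transpositions :: "nat \<Rightarrow> (nat \<Rightarrow> nat) set" where
  "transpositions d = {Transposition.transpose i j | i j. i \<in> {1..d} \<and> j \<in> {1..d} \<and> i \<noteq> j}"


section \<open>Independence of representatives\<close>

locale conj_invariant = group G for G (structure) +
  fixes A
  assumes subset_carrier: "A \<subseteq> carrier G"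
    and conj_closed: "g \<in> carrier G \<Longrightarrow> a \<in> A \<Longrightarrow> conj_elt G g a \<in> A"
begin

lemma conj_closed_inv: "g \<in> A \<Longrightarrow> a \<in> A \<Longrightarrow> inv g \<otimes> a \<otimes> g \<in> A"
  using conj_closed[of "inv g" a] subset_carrier by (auto simp: conj_elt_def)

lemma conj_closed': "g \<in> A \<Longrightarrow> a \<in> A \<Longrightarrow> g \<otimes> a \<otimes> inv g \<in> A"
  using conj_closed[of g a] subset_carrier by (auto simp: conj_elt_def)

lemma fs_cong_words: "fs_cong G A u v \<Longrightarrow> u \<in> fs_words A \<and> v \<in> fs_words A"
  by (induction rule: fs_cong.induct) (auto simp: fs_words_def conj_closed_inv conj_closed')

lemma equiv_fs_rel: "equiv (fs_words A) (fs_rel G A)"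
  unfolding fs_rel_def
  by (intro equivI refl_onI symI transI)
     (auto intro: fs_cong.refl fs_cong.sym fs_cong.trans dest: fs_cong_words)

lemma fs_class_eq: "fs_cong G A u v \<Longrightarrow> fs_rel G A `` {u} = fs_rel G A `` {v}"
  by (rule equiv_class_eq[OF equiv_fs_rel]) (simp add: fs_rel_def)

lemma foldr_closed: "w \<in> lists (carrier G) \<Longrightarrow> foldr (\<otimes>) w \<one> \<in> carrier G"
  by (induction w) auto

lemma foldr_append:
  assumes "u \<in> lists (carrier G)" "v \<in> lists (carrier G)"
  shows "foldr (\<otimes>) (u @ v) \<one> = foldr (\<otimes>) u \<one> \<otimes> foldr (\<otimes>) v \<one>"
  using assms by (induction u) (auto simp: foldr_closed[simplified] m_assoc)

lemma words_carrier: "w \<in> fs_words A \<Longrightarrow> w \<in> lists (carrier G)"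
  using subset_carrier by (auto simp: fs_words_def)

lemma fs_cong_prod: "fs_cong G A u v \<Longrightarrow> foldr (\<otimes>) u \<one> = foldr (\<otimes>) v \<one>"
proof (induction rule: fs_cong.induct)
  case (swap_right g\<^sub>1 g\<^sub>2)
  then have c: "g\<^sub>1 \<in> carrier G" "g\<^sub>2 \<in> carrier G" using subset_carrier by auto
  then have "g\<^sub>2 \<otimes> (inv g\<^sub>2 \<otimes> g\<^sub>1 \<otimes> g\<^sub>2) = (g\<^sub>2 \<otimes> inv g\<^sub>2) \<otimes> g\<^sub>1 \<otimes> g\<^sub>2"
    by (simp only: m_assoc m_closed inv_closed)
  with c show ?case by simp
next
  case (swap_left g\<^sub>1 g\<^sub>2)
  then have c: "g\<^sub>1 \<in> carrier G" "g\<^sub>2 \<in> carrier G" using subset_carrier by auto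
  then show ?case by (simp add: m_assoc)
next
  case (append u u' v v')
  then show ?case using fs_cong_words words_carrier by (metis foldr_append)
qed (use subset_carrier in auto)

lemma fs_prod_class:
  assumes "w \<in> fs_words A"
  shows "fs_prod G (fs_rel G A `` {w}) = foldr (\<otimes>) w \<one>"
proof -
  have "(\<lambda>v. foldr (\<otimes>) v \<one>) ` (fs_rel G A `` {w}) = {foldr (\<otimes>) w \<one>}"
  proof -
    have "foldr (\<otimes>) v \<one> = foldr (\<otimes>) w \<one>" if "v \<in> fs_rel G A `` {w}" for v
      using that fs_cong_prod[of w v] by (simp add: fs_rel_def)
    moreover have "w \<in> fs_rel G A `` {w}"
      using fs_cong.refl[OF assms, of G] by (simp add: fs_rel_def)
    ultimately show ?thesis by blast
  qed
  then show ?thesis by (simp add: fs_prod_def)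
qed

lemma generate_eqI:
  assumes "X \<subseteq> carrier G" "Y \<subseteq> carrier G" "X \<subseteq> generate G Y" "Y \<subseteq> generate G X"
  shows "generate G X = generate G Y"
  by (meson assms generate_is_subgroup generate_subgroup_incl subset_antisym)

lemma cancel_left:
  assumes "g \<in> carrier G" "x \<in> carrier G"
  shows "g \<otimes> (inv g \<otimes> x) = x" "inv g \<otimes> (g \<otimes> x) = x"
  using assms by (simp_all flip: m_assoc)

lemma fs_cong_gen: "fs_cong G A u v \<Longrightarrow> generate G (set u) = generate G (set v)"
proof (induction rule: fs_cong.induct)
  case (swap_right g\<^sub>1 g\<^sub>2)
  define h where "h = inv g\<^sub>2 \<otimes> g\<^sub>1 \<otimes> g\<^sub>2"
  have c: "g\<^sub>1 \<in> carrier G" "g\<^sub>2 \<in> carrier G" using swap_right subset_carrier by auto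
  then have g1: "g\<^sub>1 = g\<^sub>2 \<otimes> h \<otimes> inv g\<^sub>2" by (simp add: h_def m_assoc cancel_left)
  have "h \<in> generate G {g\<^sub>1, g\<^sub>2}"
    unfolding h_def by (rule generate.eng[OF generate.eng[OF generate.inv generate.incl] generate.incl]) auto
  moreover have "g\<^sub>1 \<in> generate G {g\<^sub>2, h}"
    by (subst g1, rule generate.eng[OF generate.eng[OF generate.incl generate.incl] generate.inv]) auto
  moreover have "h \<in> carrier G" using c by (simp add: h_def)
  ultimately have "generate G {g\<^sub>1, g\<^sub>2} = generate G {g\<^sub>2, h}"
    using c by (intro generate_eqI) (simp_all add: generate.incl)
  then show ?case by (simp add: h_def)
next
  case (swap_left g\<^sub>1 g\<^sub>2)
  define h where "h = g\<^sub>1 \<otimes> g\<^sub>2 \<otimes> inv g\<^sub>1"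
  have c: "g\<^sub>1 \<in> carrier G" "g\<^sub>2 \<in> carrier G" using swap_left subset_carrier by auto
  then have g2: "g\<^sub>2 = inv g\<^sub>1 \<otimes> h \<otimes> g\<^sub>1" by (simp add: h_def m_assoc cancel_left)
  have "h \<in> generate G {g\<^sub>1, g\<^sub>2}"
    unfolding h_def by (rule generate.eng[OF generate.eng[OF generate.incl generate.incl] generate.inv]) auto
  moreover have "g\<^sub>2 \<in> generate G {h, g\<^sub>1}"
    by (subst g2, rule generate.eng[OF generate.eng[OF generate.inv generate.incl] generate.incl]) auto
  moreover have "h \<in> carrier G" using c by (simp add: h_def)
  ultimately have "generate G {g\<^sub>1, g\<^sub>2} = generate G {h, g\<^sub>1}"
    using c by (intro generate_eqI) (simp_all add: generate.incl)
  then show ?case by (simp add: h_def)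
next
  case (unit g)
  then show ?case using subset_carrier
    by (intro generate_eqI) (auto intro: generate.incl generate.one)
next
  case (append u u' v v')
  have sub: "set x \<subseteq> carrier G" if "x \<in> fs_words A" for x
    using words_carrier[OF that] by auto
  have c: "set u \<subseteq> carrier G" "set u' \<subseteq> carrier G" "set v \<subseteq> carrier G" "set v' \<subseteq> carrier G"
    using append.hyps fs_cong_words sub by blast+
  have 1: "set x \<subseteq> generate G (set x' \<union> set y')"
    if "generate G (set x) = generate G (set x')" for x x' y' :: "'a list"
    using that mono_generate[of "set x'" "set x' \<union> set y'"] by (auto intro: generate.incl)
  show ?case
    unfolding set_append using 1[of u u' v'] 1[of v v' u'] 1[of u' u v] 1[of v' v u] append.IH c
    by (intro generate_eqI) (simp_all add: Un_commute)
qed simp_all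

lemma fs_gen_class:
  assumes "w \<in> fs_words A"
  shows "fs_gen G (fs_rel G A `` {w}) = generate G (set w)"
proof -
  have "(\<lambda>v. generate G (set v)) ` (fs_rel G A `` {w}) = {generate G (set w)}"
  proof -
    have "generate G (set v) = generate G (set w)" if "v \<in> fs_rel G A `` {w}" for v
      using that fs_cong_gen[of w v] by (simp add: fs_rel_def)
    moreover have "w \<in> fs_rel G A `` {w}"
      using fs_cong.refl[OF assms, of G] by (simp add: fs_rel_def)
    ultimately show ?thesis by blast
  qed
  then show ?thesis by (simp add: fs_gen_def)
qed

lemma fs_mult_class:
  assumes "u \<in> fs_words A" "v \<in> fs_words A"
  shows "fs_mult G A (fs_rel G A `` {u}) (fs_rel G A `` {v}) = fs_rel G A `` {u @ v}"
proof -
  have "fs_rel G A `` {u' @ v'} = fs_rel G A `` {u @ v}" if "fs_cong G A u u'" "fs_cong G A v v'"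
    for u' v' using fs_class_eq[OF fs_cong.append[OF that]] by simp
  then have "fs_rel G A `` {u' @ v'} = fs_rel G A `` {u @ v}"
    if "u' \<in> fs_rel G A `` {u}" "v' \<in> fs_rel G A `` {v}" for u' v'
    using that by (simp add: fs_rel_def)
  moreover have "u \<in> fs_rel G A `` {u}" "v \<in> fs_rel G A `` {v}"
    using fs_cong.refl[OF assms(1), of G] fs_cong.refl[OF assms(2), of G] by (simp_all add: fs_rel_def)
  ultimately show ?thesis unfolding fs_mult_def by blast
qed

lemma conj_elt_mult:
  assumes "g \<in> carrier G" "a \<in> carrier G" "b \<in> carrier G"
  shows "conj_elt G g (a \<otimes> b) = conj_elt G g a \<otimes> conj_elt G g b"
proof -
  have "inv g \<otimes> (g \<otimes> (b \<otimes> inv g)) = b \<otimes> inv g" using assms by (simp add: m_assoc[symmetric])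
  with assms show ?thesis by (simp add: conj_elt_def m_assoc)
qed

lemma conj_elt_inv:
  assumes "g \<in> carrier G" "a \<in> carrier G"
  shows "conj_elt G g (inv a) = inv (conj_elt G g a)"
  using assms by (simp add: conj_elt_def m_assoc inv_mult_group)

lemma fs_cong_conj:
  assumes g: "g \<in> carrier G" and "fs_cong G A u v"
  shows "fs_cong G A (map (conj_elt G g) u) (map (conj_elt G g) v)"
  using assms(2)
proof (induction rule: fs_cong.induct)
  case (swap_right g\<^sub>1 g\<^sub>2)
  then have c: "g\<^sub>1 \<in> carrier G" "g\<^sub>2 \<in> carrier G" using subset_carrier by auto
  show ?case
    using fs_cong.swap_right[OF conj_closed conj_closed, of g g\<^sub>1 g g\<^sub>2] swap_right g c
    by (simp add: conj_elt_mult conj_elt_inv)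
next
  case (swap_left g\<^sub>1 g\<^sub>2)
  then have c: "g\<^sub>1 \<in> carrier G" "g\<^sub>2 \<in> carrier G" using subset_carrier by auto
  show ?case
    using fs_cong.swap_left[OF conj_closed conj_closed, of g g\<^sub>1 g g\<^sub>2] swap_left g c
    by (simp add: conj_elt_mult conj_elt_inv)
next
  case (unit a)
  have "conj_elt G g \<one> = \<one>" using g by (simp add: conj_elt_def)
  then show ?case using fs_cong.unit[OF conj_closed[OF g unit(1)]] unit(2) by simp
next
  case (refl w)
  then show ?case using g conj_closed by (intro fs_cong.refl) (auto simp: fs_words_def)
next
  case (append u u' v v')
  then show ?case by (auto intro: fs_cong.append)
qed (blast intro: fs_cong.sym fs_cong.trans)+

lemma fs_act_class:
  assumes "g \<in> carrier G" "w \<in> fs_words A"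
  shows "fs_act G A g (fs_rel G A `` {w}) = fs_rel G A `` {map (conj_elt G g) w}"
proof -
  have "fs_rel G A `` {map (conj_elt G g) w'} = fs_rel G A `` {map (conj_elt G g) w}"
    if "fs_cong G A w w'" for w'
    using fs_class_eq[OF fs_cong_conj[OF assms(1) that]] by simp
  then have "fs_rel G A `` {map (conj_elt G g) w'} = fs_rel G A `` {map (conj_elt G g) w}"
    if "w' \<in> fs_rel G A `` {w}" for w'
    using that by (simp add: fs_rel_def)
  moreover have "w \<in> fs_rel G A `` {w}"
    using fs_cong.refl[OF assms(2), of G] by (simp add: fs_rel_def)
  ultimately show ?thesis unfolding fs_act_def by blast
qed

lemma fs_mult_full_closed:
  assumes "s \<in> full_fact_semigroup G A" "t \<in> full_fact_semigroup G A"
  shows "fs_mult G A s t \<in> full_fact_semigroup G A"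
proof -
  from assms obtain u v where u: "u \<in> fs_words A" "s = fs_rel G A `` {u}"
    and v: "v \<in> fs_words A" "t = fs_rel G A `` {v}"
    unfolding full_fact_semigroup_def fact_semigroup_def quotient_def by blast
  have uv: "u @ v \<in> fs_words A" using u v by (auto simp: fs_words_def)
  have gu: "generate G (set u) = carrier G"
    using assms(1) u fs_gen_class by (auto simp: full_fact_semigroup_def)
  have "carrier G \<subseteq> generate G (set (u @ v))"
    using mono_generate[of "set u" "set (u @ v)"] gu by auto
  moreover have "generate G (set (u @ v)) \<subseteq> carrier G"
    using words_carrier[OF uv] by (intro generate_incl) auto
  ultimately show ?thesis
    using u v uv fs_mult_class fs_gen_class quotientI[OF uv]
    by (auto simp: full_fact_semigroup_def fact_semigroup_def)
qed

end

lemma (in group) conj_invariant_conj_class: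
  assumes "a \<in> carrier G"
  shows "conj_invariant G (conj_class G a)"
proof
  show "conj_class G a \<subseteq> carrier G" using assms by (auto simp: conj_class_def conj_elt_def)
next
  fix g b assume g: "g \<in> carrier G" and "b \<in> conj_class G a"
  then obtain h where h: "h \<in> carrier G" "b = conj_elt G h a" by (auto simp: conj_class_def)
  then have "conj_elt G g b = conj_elt G (g \<otimes> h) a"
    using g assms by (simp add: conj_elt_def m_assoc inv_mult_group)
  then show "conj_elt G g b \<in> conj_class G a" using g h by (auto simp: conj_class_def)
qed

lemma conj_invariant_transpositions: "conj_invariant (sym_group d) (transpositions d)"
proof -
  interpret group "sym_group d" by (rule sym_group_is_group)
  show ?thesis
  proof
    show "transpositions d \<subseteq> carrier (sym_group d)"
      by (auto simp: transpositions_def sym_group_carrier intro!: permutes_swap_id)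
  next
    fix g t assume g: "g \<in> carrier (sym_group d)" and "t \<in> transpositions d"
    then obtain i j where t: "t = Transposition.transpose i j" "i \<in> {1..d}" "j \<in> {1..d}" "i \<noteq> j"
      by (auto simp: transpositions_def)
    have p: "g permutes {1..d}" using g by (simp add: sym_group_carrier)
    then have b: "bij g" by (rule permutes_bij)
    have "inv\<^bsub>sym_group d\<^esub> g = inv' g"
      using p by (intro inv_equality)
        (auto simp: sym_group_def permutes_inv permutes_inv_o)
    moreover have "g \<circ> Transposition.transpose i j \<circ> inv' g = Transposition.transpose (g i) (g j)"
    proof
      fix x
      obtain y where x: "x = g y" using b by (metis bij_pointE)
      have "inj g" using b by (rule bij_is_inj)
      then show "(g \<circ> Transposition.transpose i j \<circ> inv' g) x = Transposition.transpose (g i) (g j) x"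
        by (auto simp: x Transposition.transpose_def inj_eq)
    qed
    moreover have "g i \<in> {1..d}" "g j \<in> {1..d}" "g i \<noteq> g j"
      using t p permutes_in_image[OF p] permutes_inj[OF p] by (auto simp only: inj_eq)
    ultimately show "conj_elt (sym_group d) g t \<in> transpositions d"
      by (auto simp: transpositions_def conj_elt_def t(1) sym_group_mult)
  qed
qed

end

theory Submission
  imports Defs
begin

text \<open>
  The natural candidate for the embedding replaces each letter \<open>(k l) = g (i\<^sub>1 i\<^sub>2) g\<^sup>-\<^sup>1\<close> of a word by
  \<open>\<rho>(g)(s)\<close>, where \<open>s\<close> is the given element over \<open>(i\<^sub>1 i\<^sub>2)\<close>. This depends on \<open>g\<close> unless \<open>s\<close> is fixed by
  the whole centralizer \<open>Z\<close> of \<open>(i\<^sub>1 i\<^sub>2)\<close>, and it need not be: for \<open>\<sigma> = (1 2)(3 4 5)\<close> and \<open>d = 7\<close> the cube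
  of the letter \<open>\<sigma>\<close> lies over \<open>(1 2)\<close> and is fixed by \<open>(6 7)\<close>, but not by \<open>(4 5)\<close>. So \<open>s\<close> is replaced
  by \<open>W = s z\<^sup>2\<close>, where \<open>z\<close> is the product of the squares of all \<open>\<rho>(g)(s)\<close>, a central and
  \<open>\<rho>\<close>-invariant element with \<open>\<alpha>(z) = 1\<close>.

  The reason why \<open>W\<close> is fixed by \<open>Z\<close> is best seen in the group of fractions, where the elements
  over \<open>1\<close> are central and are not moved by the symmetric group. There
  \<open>h \<mapsto> \<rho>(h)(s) s\<^sup>-\<^sup>1\<close> is a homomorphism from \<open>Z\<close> to an abelian group. It is trivial on \<open>(i\<^sub>1 i\<^sub>2)\<close> and, by
  hypothesis, on \<open>(i\<^sub>3 i\<^sub>4)\<close>, hence on all conjugates of the latter in \<open>Z\<close>, which are the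
  transpositions disjoint from \<open>(i\<^sub>1 i\<^sub>2)\<close>; and these elements generate \<open>Z\<close>. Two factors \<open>z\<close> are enough
  for all the cancellations that the argument needs; this is the content of \<open>fixed_in_fibre\<close> and
  \<open>stabilized_word\<close>.

  Once \<open>W\<close> is fixed by \<open>Z\<close>, the substitution is well defined, compatible with the defining
  relations, with \<open>\<alpha>\<close> and with \<open>\<rho>\<close>; this is the locale \<open>letter_substitution\<close>. The image of a word
  determines its product, and also its length, because the identity is not in \<open>C\<close> and the relations
  then preserve the length. Injectivity therefore amounts to the theorem of Clebsch and Hurwitz
  that words of transpositions which generate the symmetric group are equivalent if they have the
  same product and the same length (\<open>transposition_words_equivalent\<close>).
\<close>

section \<open>Words up to Hurwitz equivalence\<close>

context conj_invariant
begin

abbreviation word_prod :: "'a list \<Rightarrow> 'a" where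
  "word_prod w \<equiv> foldr (\<otimes>) w \<one>"

abbreviation conj_word :: "'a \<Rightarrow> 'a list \<Rightarrow> 'a list" where
  "conj_word g \<equiv> map (conj_elt G g)"

text \<open>The defining congruence lives on nonempty words. The pair of empty words is added so that the
  factors of a decomposed word may be empty.\<close>

definition heq :: "'a list \<Rightarrow> 'a list \<Rightarrow> bool" (infix "\<approx>" 50) where
  "u \<approx> v \<longleftrightarrow> fs_cong G A u v \<or> u = [] \<and> v = []"

lemma heq_refl [intro]: "w \<in> lists A \<Longrightarrow> w \<approx> w"
  by (cases "w = []") (auto simp: heq_def fs_words_def intro: fs_cong.refl)

lemma heq_sym: "u \<approx> v \<Longrightarrow> v \<approx> u"
  by (auto simp: heq_def intro: fs_cong.sym)

lemma heq_nonempty: "u \<approx> v \<Longrightarrow> u \<noteq> [] \<or> v \<noteq> [] \<Longrightarrow> fs_cong G A u v"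
  by (auto simp: heq_def)

lemma heq_lists: "u \<approx> v \<Longrightarrow> u \<in> lists A \<and> v \<in> lists A"
  unfolding heq_def using fs_cong_words by (auto simp: fs_words_def)

lemma heq_trans [trans]: "u \<approx> v \<Longrightarrow> v \<approx> w \<Longrightarrow> u \<approx> w"
  unfolding heq_def using fs_cong_words by (auto simp: fs_words_def intro: fs_cong.trans)

lemma heq_append: "u \<approx> u' \<Longrightarrow> v \<approx> v' \<Longrightarrow> u @ v \<approx> u' @ v'"
  by (auto simp: heq_def intro: fs_cong.append)

lemma heq_context:
  "u \<approx> u' \<Longrightarrow> a \<in> lists A \<Longrightarrow> b \<in> lists A \<Longrightarrow> a @ u @ b \<approx> a @ u' @ b"
  by (intro heq_append heq_refl)

lemma heq_prod: "u \<approx> v \<Longrightarrow> word_prod u = word_prod v"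
  by (auto simp: heq_def intro: fs_cong_prod)

lemma heq_generate: "u \<approx> v \<Longrightarrow> generate G (set u) = generate G (set v)"
  unfolding heq_def using fs_cong_gen by blast

lemma heq_conj_word: "g \<in> carrier G \<Longrightarrow> u \<approx> v \<Longrightarrow> conj_word g u \<approx> conj_word g v"
  by (auto simp: heq_def intro: fs_cong_conj)

lemma letters_carrier: "w \<in> lists A \<Longrightarrow> w \<in> lists (carrier G)"
  using subset_carrier by auto

lemma word_prod_closed: "w \<in> lists A \<Longrightarrow> word_prod w \<in> carrier G"
  by (intro foldr_closed letters_carrier)

lemma word_prod_append:
  "u \<in> lists A \<Longrightarrow> v \<in> lists A \<Longrightarrow> word_prod (u @ v) = word_prod u \<otimes> word_prod v"
  by (intro foldr_append letters_carrier)

lemma conj_word_lists: "g \<in> carrier G \<Longrightarrow> w \<in> lists A \<Longrightarrow> conj_word g w \<in> lists A"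
  using conj_closed by auto

lemma conj_elt_closed: "g \<in> carrier G \<Longrightarrow> a \<in> carrier G \<Longrightarrow> conj_elt G g a \<in> carrier G"
  by (simp add: conj_elt_def)

lemma conj_elt_conj_elt:
  "g \<in> carrier G \<Longrightarrow> h \<in> carrier G \<Longrightarrow> a \<in> carrier G \<Longrightarrow>
    conj_elt G g (conj_elt G h a) = conj_elt G (g \<otimes> h) a"
  by (simp add: conj_elt_def m_assoc inv_mult_group)

lemma conj_elt_one [simp]: "a \<in> carrier G \<Longrightarrow> conj_elt G \<one> a = a"
  by (simp add: conj_elt_def)

lemma conj_word_conj_word:
  "g \<in> carrier G \<Longrightarrow> h \<in> carrier G \<Longrightarrow> w \<in> lists A \<Longrightarrow>
    conj_word g (conj_word h w) = conj_word (g \<otimes> h) w"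
  using subset_carrier by (auto simp: conj_elt_conj_elt)

lemma conj_word_one: "w \<in> lists A \<Longrightarrow> conj_word \<one> w = w"
  using subset_carrier by (induction w) auto

lemma word_prod_conj_word:
  assumes "g \<in> carrier G" "w \<in> lists A"
  shows "word_prod (conj_word g w) = conj_elt G g (word_prod w)"
  using assms(2)
proof (induction w)
  case Nil
  then show ?case using assms(1) by (simp add: conj_elt_def)
next
  case (Cons a w)
  then have "a \<in> carrier G" using subset_carrier by auto
  with Cons show ?case using assms(1) word_prod_closed[of w] by (simp add: conj_elt_mult)
qed

lemma letter_past_word:
  assumes "a \<in> A" "v \<in> lists A"
  shows "a # v \<approx> conj_word a v @ [a]"
  using assms(2)
proof (induction v)
  case Nil
  then show ?case using assms by auto
next
  case (Cons b v)
  have a: "a \<in> carrier G" using assms(1) subset_carrier by auto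
  have "[a, b] \<approx> [conj_elt G a b, a]"
    using fs_cong.swap_left[OF assms(1), of b G] Cons by (simp add: heq_def conj_elt_def)
  then have "[a, b] @ v \<approx> [conj_elt G a b, a] @ v"
    using Cons by (intro heq_append) auto
  also have "[conj_elt G a b, a] @ v = [conj_elt G a b] @ (a # v)" by simp
  also have "\<dots> \<approx> [conj_elt G a b] @ (conj_word a v @ [a])"
    using Cons a conj_closed by (intro heq_append) auto
  finally show ?case by simp
qed

text \<open>The commutation rule \<open>s \<cdot> t = \<rho>(\<alpha>(s))(t) \<cdot> s\<close>: a factor may jump over another one at the
  price of conjugating it. All manipulations of words below are instances of it.\<close>

lemma word_past_word:
  assumes "u \<in> lists A" "v \<in> lists A"
  shows "u @ v \<approx> conj_word (word_prod u) v @ u"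
  using assms(1)
proof (induction u)
  case Nil
  then show ?case using assms by (auto simp: conj_word_one)
next
  case (Cons a u)
  then have a: "a \<in> A" "a \<in> carrier G" and u: "u \<in> lists A" "word_prod u \<in> carrier G"
    using subset_carrier word_prod_closed by auto
  have "[a] @ (u @ v) \<approx> [a] @ (conj_word (word_prod u) v @ u)"
    using Cons a by (intro heq_append[OF heq_refl]) auto
  also have "[a] @ (conj_word (word_prod u) v @ u) = (a # conj_word (word_prod u) v) @ u" by simp
  also have "\<dots> \<approx> (conj_word a (conj_word (word_prod u) v) @ [a]) @ u"
    using a u assms by (intro heq_append letter_past_word heq_refl conj_word_lists)
  also have "conj_word a (conj_word (word_prod u) v) = conj_word (word_prod (a # u)) v"
    using a u assms by (subst conj_word_conj_word) auto
  finally show ?case by simp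
qed

lemma central_word:
  assumes "u \<in> lists A" "v \<in> lists A" "word_prod u = \<one>"
  shows "u @ v \<approx> v @ u"
  using word_past_word[OF assms(1,2)] assms by (simp add: conj_word_one)

lemma word_past_word_back:
  assumes "u \<in> lists A" "v \<in> lists A"
  shows "u @ v \<approx> v @ conj_word (inv (word_prod v)) u"
proof -
  have c: "word_prod v \<in> carrier G" using assms word_prod_closed by auto
  have l: "conj_word (inv (word_prod v)) u \<in> lists A" using c assms by (intro conj_word_lists) auto
  have "conj_word (word_prod v) (conj_word (inv (word_prod v)) u) = u"
    using c assms by (subst conj_word_conj_word) (auto simp: conj_word_one[simplified])
  then show ?thesis using word_past_word[OF assms(2) l] heq_sym by simp
qed

text \<open>Blocks of trivial product are central, so they commute with each other.\<close>

lemma concat_rearrange: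
  assumes "mset xs = mset ys"
    and F: "\<And>x. x \<in> set xs \<Longrightarrow> F x \<in> lists A \<and> word_prod (F x) = \<one>"
  shows "concat (map F xs) \<approx> concat (map F ys)"
  using assms
proof (induction xs arbitrary: ys)
  case Nil
  then show ?case by auto
next
  case (Cons x xs)
  then obtain ys1 ys2 where ys: "ys = ys1 @ x # ys2"
    by (metis list.set_intros(1) mset_eq_setD split_list)
  have eq: "mset xs = mset (ys1 @ ys2)" using Cons.prems(1) ys by simp
  then have s: "set xs = set ys1 \<union> set ys2" by (metis mset_eq_setD set_append)
  have Fx: "F x \<in> lists A" "word_prod (F x) = \<one>" using Cons.prems by auto
  have l1: "concat (map F ys1) \<in> lists A" and l2: "concat (map F ys2) \<in> lists A"
    using Cons.prems(2) s by (auto simp: in_lists_conv_set)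
  have "concat (map F (x # xs)) \<approx> F x @ concat (map F (ys1 @ ys2))"
    using Cons.IH[OF eq] Cons.prems Fx by (auto intro!: heq_append)
  also have "\<dots> = (F x @ concat (map F ys1)) @ concat (map F ys2)" by simp
  also have "\<dots> \<approx> (concat (map F ys1) @ F x) @ concat (map F ys2)"
    using l1 l2 Fx by (intro heq_append central_word heq_refl)
  finally show ?case by (simp add: ys)
qed

end

lemma (in conj_invariant) fs_cong_length:
  assumes "\<one> \<notin> A" "fs_cong G A u v"
  shows "length u = length v"
  using assms(2,1) by (induction rule: fs_cong.induct) auto

lemma (in conj_invariant) class_eqD:
  assumes "fs_rel G A `` {u} = fs_rel G A `` {v}" "v \<in> fs_words A"
  shows "fs_cong G A u v"
proof -
  have "v \<in> fs_rel G A `` {v}" using fs_cong.refl[OF assms(2), of G] by (simp add: fs_rel_def)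
  then have "v \<in> fs_rel G A `` {u}" using assms(1) by simp
  then show ?thesis by (simp add: fs_rel_def)
qed

lemma (in conj_invariant) full_fact_semigroupE:
  assumes "s \<in> full_fact_semigroup G A"
  obtains u where "u \<in> fs_words A" "s = fs_rel G A `` {u}" "generate G (set u) = carrier G"
proof -
  from assms obtain u where "u \<in> fs_words A" "s = fs_rel G A `` {u}"
    unfolding full_fact_semigroup_def fact_semigroup_def quotient_def by blast
  then show ?thesis
    using that[of u] assms fs_gen_class by (auto simp: full_fact_semigroup_def)
qed

lemma (in group) one_in_conj_class:
  assumes "a \<in> carrier G" "\<one> \<in> conj_class G a"
  shows "a = \<one>"
proof -
  obtain g where g: "g \<in> carrier G" "\<one> = g \<otimes> a \<otimes> inv g"
    using assms(2) by (auto simp: conj_class_def conj_elt_def)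
  then have "g \<otimes> a = g \<otimes> \<one>" using inv_solve_right[of \<one> "g \<otimes> a" g] assms(1) by simp
  then show ?thesis using g(1) assms(1) by simp
qed

lemma (in conj_invariant) conj_word_fixed_mult:
  assumes "g \<in> carrier G" "h \<in> carrier G" "W \<in> lists A" "conj_word g W \<approx> W" "conj_word h W \<approx> W"
  shows "conj_word (g \<otimes> h) W \<approx> W"
  using heq_trans[OF heq_conj_word[OF assms(1,5)] assms(4)] assms(1-3)
  by (simp only: conj_word_conj_word)

section \<open>Invariance under a centralizer after multiplication by a central element\<close>

context conj_invariant
begin

text \<open>The element \<open>z\<close> is the product of \<open>(\<rho>(g)(w))\<^sup>2\<close> over all \<open>g\<close>. Each square has trivial product,
  hence is central, so the order of the factors is irrelevant; \<open>\<rho>(h)\<close> only permutes them, and any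
  one of them can be moved to the front. Multiplication by \<open>z\<close> serves as a substitute for passing
  to the group of fractions: whenever two words agree after multiplication by some \<open>\<rho>(g)(w)\<close>, they
  agree after multiplication by \<open>z\<close>.\<close>

lemma central_invariant_multiple:
  assumes fin: "finite (carrier G)" and w: "w \<in> lists A" and sq: "word_prod w \<otimes> word_prod w = \<one>"
  obtains z where "z \<in> lists A" "word_prod z = \<one>"
    "\<And>h. h \<in> carrier G \<Longrightarrow> conj_word h z \<approx> z"
    "\<And>g. g \<in> carrier G \<Longrightarrow> \<exists>r \<in> lists A. z \<approx> conj_word g w @ conj_word g w @ r"
proof -
  obtain gs where gs: "set gs = carrier G" "distinct gs"
    using fin finite_distinct_list by blast
  define F where "F = (\<lambda>g. conj_word g w @ conj_word g w)"
  have wc: "word_prod w \<in> carrier G" using w word_prod_closed by auto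
  have F: "F g \<in> lists A \<and> word_prod (F g) = \<one>" if "g \<in> carrier G" for g
  proof -
    have l: "conj_word g w \<in> lists A" using that w by (rule conj_word_lists)
    have "word_prod (F g) = conj_elt G g (word_prod w) \<otimes> conj_elt G g (word_prod w)"
      unfolding F_def using l that w by (simp only: word_prod_append word_prod_conj_word)
    also have "\<dots> = conj_elt G g \<one>" using that wc sq by (simp flip: conj_elt_mult)
    also have "\<dots> = \<one>" using that by (simp add: conj_elt_def)
    finally show ?thesis using l by (simp add: F_def)
  qed
  have block: "concat (map F xs) \<in> lists A \<and> word_prod (concat (map F xs)) = \<one>"
    if "set xs \<subseteq> carrier G" for xs
    using that
  proof (induction xs)
    case (Cons x xs)
    then show ?case using F[of x] by (auto simp del: List.foldr_append simp: word_prod_append)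
  qed simp
  define z where "z = concat (map F gs)"
  have inv: "conj_word h z \<approx> z" if h: "h \<in> carrier G" for h
  proof -
    have "conj_word h (F g) = F (h \<otimes> g)" if "g \<in> carrier G" for g
      using h that w conj_word_conj_word[of h g w] by (simp add: F_def)
    then have "conj_word h z = concat (map F (map ((\<otimes>) h) gs))"
      using gs(1) by (auto simp: z_def map_concat intro!: arg_cong[where f = concat])
    moreover have "mset (map ((\<otimes>) h) gs) = mset gs"
    proof -
      have "inj_on ((\<otimes>) h) (carrier G)" using h inj_on_cmult by blast
      then have "distinct (map ((\<otimes>) h) gs)" using gs by (simp add: distinct_map)
      moreover have "set (map ((\<otimes>) h) gs) = set gs"
        using gs(1) h surj_const_mult by auto
      ultimately show ?thesis using gs(2) set_eq_iff_mset_eq_distinct by blast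
    qed
    ultimately show ?thesis
      using concat_rearrange[of "map ((\<otimes>) h) gs" gs F] F h gs(1) by (auto simp: z_def)
  qed
  have div: "\<exists>r \<in> lists A. z \<approx> conj_word g w @ conj_word g w @ r" if "g \<in> carrier G" for g
  proof
    have "mset gs = mset (g # remove1 g gs)" using that gs(1) by simp
    then have "z \<approx> concat (map F (g # remove1 g gs))"
      unfolding z_def using F gs(1) by (intro concat_rearrange) auto
    then show "z \<approx> conj_word g w @ conj_word g w @ concat (map F (remove1 g gs))"
      by (simp add: F_def)
    show "concat (map F (remove1 g gs)) \<in> lists A"
      using block set_remove1_subset gs(1) by metis
  qed
  show ?thesis
    using that[of z] block[of gs] gs(1) inv div by (auto simp: z_def)
qed

text \<open>The commutation rule gives \<open>\<rho>(h)(u) \<cdot> x = x \<cdot> u = u \<cdot> x\<close> for \<open>x = \<rho>(g)(w)\<close>, \<open>h = \<alpha>(x)\<close> and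
  central \<open>u\<close>; the multiple \<open>z\<close> of \<open>x\<close> replaces the cancellation of \<open>x\<close>.\<close>

lemma central_word_conj_invariant:
  assumes w: "w \<in> lists A" and g: "g \<in> carrier G"
    and z: "z \<approx> conj_word g w @ r" "r \<in> lists A"
    and u: "u \<in> lists A" "word_prod u = \<one>"
    and h: "h = conj_elt G g (word_prod w)"
  shows "conj_word h u @ z \<approx> u @ z"
proof -
  let ?x = "conj_word g w"
  have x: "?x \<in> lists A" using g w by (rule conj_word_lists)
  have hx: "word_prod ?x = h" using g w h by (simp add: word_prod_conj_word)
  have hc: "h \<in> carrier G" using x hx word_prod_closed by blast
  have hu: "conj_word h u \<in> lists A" using hc u by (intro conj_word_lists)
  have "conj_word h u @ ?x \<approx> ?x @ u" using word_past_word[OF x u(1)] hx heq_sym by simp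
  also have "?x @ u \<approx> u @ ?x" using central_word[OF u(1) x u(2)] by (rule heq_sym)
  finally have swap: "conj_word h u @ ?x \<approx> u @ ?x" .
  have "conj_word h u @ z \<approx> conj_word h u @ (?x @ r)" using hu z by (intro heq_append heq_refl)
  also have "\<dots> = (conj_word h u @ ?x) @ r" by simp
  also have "\<dots> \<approx> (u @ ?x) @ r" using swap z by (intro heq_append[OF swap heq_refl])
  also have "\<dots> = u @ (?x @ r)" by simp
  also have "\<dots> \<approx> u @ z" using u z by (intro heq_append heq_refl heq_sym[of z])
  finally show ?thesis .
qed

text \<open>Two elements \<open>u\<close> and \<open>w\<close> with the same product differ, up to cancellation, by a central
  element, and by the previous lemma \<open>\<rho>(h)\<close> does not move central elements. Hence \<open>\<rho>(h)\<close> fixes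
  \<open>u\<close> as soon as it fixes \<open>w\<close>. To avoid inverses, the argument is applied to the central word
  \<open>u \<cdot> w\<close>: one factor \<open>z\<close> absorbs the conjugation, the other one absorbs the cancellation of \<open>w\<close>.\<close>

lemma fixed_in_fibre:
  assumes w: "w \<in> lists A" and sq: "word_prod w \<otimes> word_prod w = \<one>"
    and z: "z \<in> lists A" "word_prod z = \<one>"
    and div: "\<And>g. g \<in> carrier G \<Longrightarrow> \<exists>r \<in> lists A. z \<approx> conj_word g w @ conj_word g w @ r"
    and u: "u \<in> lists A" "word_prod u = word_prod w"
    and h: "g \<in> carrier G" "h = conj_elt G g (word_prod w)" "conj_word h w \<approx> w"
  shows "conj_word h u @ z @ z \<approx> u @ z @ z"
proof -
  have hc: "h \<in> carrier G" using h w word_prod_closed by (auto intro: conj_elt_closed)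
  have hu: "conj_word h u \<in> lists A" using hc u by (intro conj_word_lists)
  obtain r where r: "r \<in> lists A" "z \<approx> conj_word g w @ conj_word g w @ r"
    using div h by blast
  have uw: "u @ w \<in> lists A" "word_prod (u @ w) = \<one>"
    using u w sq by (auto simp del: List.foldr_append simp: word_prod_append)
  have inv: "conj_word h (u @ w) @ z \<approx> (u @ w) @ z"
    using r conj_word_lists[OF h(1) w]
    by (intro central_word_conj_invariant[OF w h(1) r(2) _ uw h(2)]) simp
  have "conj_word h u @ w @ z \<approx> conj_word h u @ conj_word h w @ z"
    using hu z heq_sym[OF h(3)] by (intro heq_append heq_refl)
  also have "\<dots> \<approx> u @ w @ z" using inv by simp
  finally have swap: "conj_word h u @ w @ z \<approx> u @ w @ z" .
  obtain q where q: "q \<in> lists A" "z \<approx> conj_word \<one> w @ conj_word \<one> w @ q"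
    using div by blast
  then have zq: "z \<approx> w @ w @ q" using w by (simp add: conj_word_one)
  have zz: "z @ z \<approx> w @ z @ w @ q"
  proof -
    have "z @ z \<approx> (w @ w @ q) @ z" using zq z by (intro heq_append heq_refl)
    also have "\<dots> = w @ ((w @ q) @ z)" by simp
    also have "\<dots> \<approx> w @ (z @ (w @ q))"
      using w q z by (intro heq_append heq_refl heq_sym[OF central_word]) auto
    finally show ?thesis by simp
  qed
  have "conj_word h u @ z @ z \<approx> conj_word h u @ w @ z @ w @ q"
    by (rule heq_append[OF heq_refl[OF hu] zz])
  also have "\<dots> = (conj_word h u @ w @ z) @ w @ q" by simp
  also have "\<dots> \<approx> (u @ w @ z) @ w @ q" using w q by (intro heq_append[OF swap heq_refl]) auto
  also have "\<dots> = u @ w @ z @ w @ q" by simp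
  also have "\<dots> \<approx> u @ z @ z" by (rule heq_append[OF heq_refl[OF u(1)] heq_sym[OF zz]])
  finally show ?thesis .
qed

text \<open>The commutation rule for \<open>w\<close> and \<open>w\<close> reads \<open>w \<cdot> w = \<rho>(\<alpha>(w))(w) \<cdot> w\<close>.\<close>

lemma self_conj_stable:
  assumes w: "w \<in> lists A" and z: "z \<in> lists A" "z \<approx> w @ r" "r \<in> lists A"
  shows "conj_word (word_prod w) w @ z \<approx> w @ z"
proof -
  have c: "conj_word (word_prod w) w \<in> lists A"
    using w word_prod_closed by (intro conj_word_lists)
  have "conj_word (word_prod w) w @ z \<approx> conj_word (word_prod w) w @ w @ r"
    using c z by (intro heq_append heq_refl)
  also have "\<dots> \<approx> (w @ w) @ r"
    using heq_append[OF heq_sym[OF word_past_word[OF w w]] heq_refl[OF z(3)]] by simp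
  also have "\<dots> = w @ w @ r" by simp
  also have "\<dots> \<approx> w @ z" using w z by (intro heq_append heq_refl heq_sym[of z])
  finally show ?thesis .
qed

text \<open>The element \<open>W = w z\<^sup>2\<close> has the same product as \<open>w\<close> but more symmetries: if \<open>\<rho>(h)\<close> fixes \<open>w\<close>, then
  every conjugate of \<open>h\<close> by an element \<open>a\<close> of the centralizer of \<open>\<alpha>(w)\<close> fixes \<open>W\<close>. Indeed
  \<open>\<rho>(a\<^sup>-\<^sup>1)(w)\<close> lies in the same fibre of \<open>\<alpha>\<close> as \<open>w\<close>, so that the lemma on fibres applies to it; then
  \<open>\<rho>(a)\<close> is applied.\<close>

proposition stabilized_word:
  assumes fin: "finite (carrier G)" and w: "w \<in> fs_words A"
    and sq: "word_prod w \<otimes> word_prod w = \<one>"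
  obtains W where "W \<in> fs_words A" "word_prod W = word_prod w"
    "conj_word (word_prod w) W \<approx> W"
    "\<And>a g h. \<lbrakk>a \<in> carrier G; conj_elt G a (word_prod w) = word_prod w; g \<in> carrier G;
        h = conj_elt G g (word_prod w); conj_word h w \<approx> w\<rbrakk>
      \<Longrightarrow> conj_word (conj_elt G a h) W \<approx> W"
proof -
  have wl: "w \<in> lists A" and ne: "w \<noteq> []" using w by (auto simp: fs_words_def)
  have tc: "word_prod w \<in> carrier G" using wl by (rule word_prod_closed)
  obtain z where z: "z \<in> lists A" "word_prod z = \<one>"
    and inv: "\<And>h. h \<in> carrier G \<Longrightarrow> conj_word h z \<approx> z"
    and div: "\<And>g. g \<in> carrier G \<Longrightarrow> \<exists>r \<in> lists A. z \<approx> conj_word g w @ conj_word g w @ r"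
    using central_invariant_multiple[OF fin wl sq] by blast
  define W where "W = w @ z @ z"
  have zinv: "conj_word h (z @ z) \<approx> z @ z" if "h \<in> carrier G" for h
    using heq_append[OF inv[OF that] inv[OF that]] by simp
  have zzl: "z @ z \<in> lists A" using z by simp
  have fixW: "conj_word h W \<approx> W"
    if "h \<in> carrier G" "conj_word h w @ z @ z \<approx> w @ z @ z" for h
  proof -
    have "conj_word h W \<approx> conj_word h w @ (z @ z)"
      unfolding W_def using that wl zinv[of h]
      by (simp only: map_append[of _ w], intro heq_append heq_refl conj_word_lists)
    also have "\<dots> \<approx> W" using that by (simp add: W_def)
    finally show ?thesis .
  qed
  have 1: "W \<in> fs_words A" using wl ne z by (auto simp: W_def fs_words_def)
  have 2: "word_prod W = word_prod w"
    using wl z tc by (simp add: W_def word_prod_append del: List.foldr_append)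
  have 3: "conj_word (word_prod w) W \<approx> W"
  proof (rule fixW[OF tc])
    obtain r where r: "r \<in> lists A" "z \<approx> conj_word \<one> w @ conj_word \<one> w @ r" using div by blast
    have "conj_word (word_prod w) w @ z \<approx> w @ z"
      using r wl z by (intro self_conj_stable[of w z "w @ r"]) (auto simp: conj_word_one[simplified])
    then show "conj_word (word_prod w) w @ z @ z \<approx> w @ z @ z"
      using heq_append[OF _ heq_refl[OF z(1)]] by fastforce
  qed
  have 4: "conj_word (conj_elt G a h) W \<approx> W"
    if a: "a \<in> carrier G" "conj_elt G a (word_prod w) = word_prod w" and g: "g \<in> carrier G"
      and h: "h = conj_elt G g (word_prod w)" "conj_word h w \<approx> w" for a g h
  proof (rule fixW)
    have hc: "h \<in> carrier G" using g h tc by (auto intro: conj_elt_closed)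
    then show ac: "conj_elt G a h \<in> carrier G" using a by (auto intro: conj_elt_closed)
    let ?u = "conj_word (inv a) w"
    have u: "?u \<in> lists A" using a wl by (intro conj_word_lists) auto
    have "word_prod ?u = conj_elt G (inv a) (conj_elt G a (word_prod w))"
      using a wl by (simp add: word_prod_conj_word)
    also have "\<dots> = word_prod w" using a(1) tc by (simp add: conj_elt_conj_elt)
    finally have pu: "word_prod ?u = word_prod w" .
    have "conj_word h ?u @ z @ z \<approx> ?u @ z @ z"
      using wl sq z div u pu g h by (rule fixed_in_fibre)
    then have "conj_word a (conj_word h ?u @ z @ z) \<approx> conj_word a (?u @ z @ z)"
      using a(1) by (rule heq_conj_word[rotated])
    moreover have "conj_word a (conj_word h ?u) = conj_word (conj_elt G a h) w"
      using a(1) hc wl by (subst conj_word_conj_word, simp_all only: u inv_closed m_closed,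
          subst conj_word_conj_word) (auto simp: conj_elt_def m_assoc)
    moreover have "conj_word a ?u = w"
      using a(1) wl by (subst conj_word_conj_word) (auto simp: conj_word_one[simplified])
    ultimately have *: "conj_word (conj_elt G a h) w @ conj_word a (z @ z) \<approx> w @ conj_word a (z @ z)"
      by (simp only: map_append)
    have zz: "conj_word a (z @ z) \<approx> z @ z" using a(1) by (rule zinv)
    have cl: "conj_word (conj_elt G a h) w \<in> lists A" using ac wl by (rule conj_word_lists)
    have "conj_word (conj_elt G a h) w @ (z @ z) \<approx> conj_word (conj_elt G a h) w @ conj_word a (z @ z)"
      using cl heq_sym[OF zz] by (intro heq_append heq_refl)
    also note *
    also have "w @ conj_word a (z @ z) \<approx> w @ (z @ z)" using wl zz by (intro heq_append heq_refl)
    finally show "conj_word (conj_elt G a h) w @ z @ z \<approx> w @ z @ z" .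
  qed
  show ?thesis using that 1 2 3 4 by blast
qed

end

section \<open>Substituting words for letters\<close>

text \<open>A word \<open>W\<close> over \<open>A\<close> with product \<open>t\<close> can replace the letter \<open>t\<close> as soon as the whole centralizer
  of \<open>t\<close> fixes it: then \<open>\<rho>(g)(W)\<close> depends, up to equivalence, only on the conjugate \<open>g t g\<^sup>-\<^sup>1\<close>.\<close>

locale letter_substitution = conj_invariant G A + source: conj_invariant G B
  for G (structure) and A B +
  fixes t W
  assumes B_class: "B = conj_class G t"
    and one_notin_B: "\<one> \<notin> B"
    and W_word: "W \<in> fs_words A"
    and W_prod: "word_prod W = t"
    and W_fixed: "\<lbrakk>h \<in> carrier G; conj_elt G h t = t\<rbrakk> \<Longrightarrow> conj_word h W \<approx> W"
begin

definition letter_image :: "'a \<Rightarrow> 'a list" where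
  "letter_image b = conj_word (SOME g. g \<in> carrier G \<and> conj_elt G g t = b) W"

definition subst :: "'a list \<Rightarrow> 'a list" where
  "subst u = concat (map letter_image u)"

lemma W_lists: "W \<in> lists A" and W_nonempty: "W \<noteq> []"
  using W_word by (auto simp: fs_words_def)

lemma t_carrier: "t \<in> carrier G"
  using word_prod_closed[OF W_lists] W_prod by simp

lemma letterE:
  assumes "b \<in> B"
  obtains g where "g \<in> carrier G" "b = conj_elt G g t"
  using assms by (auto simp: B_class conj_class_def)

text \<open>Independence of the chosen conjugator: two choices differ by an element of the centralizer.\<close>

lemma conj_word_W:
  assumes g: "g \<in> carrier G"
  shows "conj_word g W \<approx> letter_image (conj_elt G g t)"
proof -
  define k where "k = (SOME k. k \<in> carrier G \<and> conj_elt G k t = conj_elt G g t)"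
  have k: "k \<in> carrier G" "conj_elt G k t = conj_elt G g t"
    unfolding k_def using someI[of "\<lambda>k. k \<in> carrier G \<and> conj_elt G k t = conj_elt G g t" g] g by auto
  let ?h = "inv k \<otimes> g"
  have h: "?h \<in> carrier G" using k g by simp
  have "conj_elt G ?h t = conj_elt G (inv k) (conj_elt G g t)"
    using k g t_carrier by (simp add: conj_elt_conj_elt)
  also have "\<dots> = conj_elt G (inv k) (conj_elt G k t)" using k by simp
  also have "\<dots> = t" using k(1) t_carrier by (simp add: conj_elt_conj_elt)
  finally have "conj_word k (conj_word ?h W) \<approx> conj_word k W"
    using W_fixed[OF h] heq_conj_word[OF k(1)] by blast
  moreover have "conj_word k (conj_word ?h W) = conj_word g W"
    using k g h W_lists by (simp only: conj_word_conj_word) (simp add: m_assoc[symmetric])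
  ultimately show ?thesis by (simp only: letter_image_def k_def heq_sym)
qed

lemma conj_letter_image:
  assumes "h \<in> carrier G" "b \<in> B"
  shows "conj_word h (letter_image b) \<approx> letter_image (conj_elt G h b)"
proof -
  obtain g where g: "g \<in> carrier G" "b = conj_elt G g t" using assms(2) by (rule letterE)
  have "conj_word h (letter_image b) \<approx> conj_word h (conj_word g W)"
    unfolding g(2) using assms g by (intro heq_conj_word heq_sym[OF conj_word_W])
  also have "\<dots> = conj_word (h \<otimes> g) W" using assms g W_lists by (intro conj_word_conj_word)
  also have "\<dots> \<approx> letter_image (conj_elt G (h \<otimes> g) t)" using assms g by (intro conj_word_W) simp
  also have "conj_elt G (h \<otimes> g) t = conj_elt G h b"
    using assms g t_carrier by (simp add: conj_elt_conj_elt)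
  finally show ?thesis .
qed

lemma letter_image_lists: "b \<in> B \<Longrightarrow> letter_image b \<in> lists A"
  by (elim letterE) (use conj_word_W heq_lists in blast)

lemma letter_image_prod: "b \<in> B \<Longrightarrow> word_prod (letter_image b) = b"
  by (elim letterE) (use heq_prod[OF conj_word_W] word_prod_conj_word W_lists W_prod in auto)

lemma letter_image_length [simp]: "length (letter_image b) = length W"
  by (simp add: letter_image_def)

lemma subst_append [simp]: "subst (u @ v) = subst u @ subst v"
  by (simp add: subst_def)

lemma subst_Cons: "subst (b # u) = letter_image b @ subst u"
  by (simp add: subst_def)

lemma subst_Nil [simp]: "subst [] = []"
  by (simp add: subst_def)

lemma length_subst: "length (subst u) = length W * length u"
  by (induction u) (simp_all add: subst_Cons)

lemma subst_lists: "u \<in> lists B \<Longrightarrow> subst u \<in> lists A"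
proof (induction u)
  case (Cons b u)
  then show ?case using letter_image_lists[of b] by (auto simp: subst_Cons)
qed simp

lemma subst_words: "u \<in> fs_words B \<Longrightarrow> subst u \<in> fs_words A"
  using subst_lists[of u] length_subst[of u] W_nonempty by (auto simp: fs_words_def)

lemma subst_prod: "u \<in> lists B \<Longrightarrow> word_prod (subst u) = word_prod u"
proof (induction u)
  case (Cons b u)
  then have "word_prod (subst (b # u)) = word_prod (letter_image b) \<otimes> word_prod (subst u)"
    unfolding subst_Cons by (intro word_prod_append letter_image_lists subst_lists) auto
  then show ?case using Cons letter_image_prod by simp
qed simp

lemma conj_subst:
  assumes "h \<in> carrier G" "u \<in> lists B"
  shows "conj_word h (subst u) \<approx> subst (conj_word h u)"
  using assms(2)
proof (induction u)
  case (Cons b u)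
  have "conj_word h (letter_image b) @ conj_word h (subst u)
      \<approx> letter_image (conj_elt G h b) @ subst (conj_word h u)"
    using Cons assms(1) by (intro heq_append conj_letter_image) auto
  then show ?case by (simp add: subst_Cons)
qed auto

text \<open>The images satisfy the defining relations because the commutation rule for words involves only
  the products of the images, which are the letters themselves.\<close>

lemma subst_swap:
  assumes "a \<in> B" "b \<in> B"
  shows "subst [a, b] \<approx> subst [conj_elt G a b, a]"
proof -
  have a: "a \<in> carrier G" using assms source.subset_carrier by auto
  have l: "letter_image a \<in> lists A" "letter_image b \<in> lists A"
    using assms letter_image_lists by auto
  have "letter_image a @ letter_image b \<approx> conj_word a (letter_image b) @ letter_image a"
    using word_past_word[OF l] assms letter_image_prod by simp
  also have "\<dots> \<approx> letter_image (conj_elt G a b) @ letter_image a"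
    using assms a l by (intro heq_append conj_letter_image heq_refl)
  finally show ?thesis by (simp add: subst_Cons)
qed

lemma subst_cong: "fs_cong G B u v \<Longrightarrow> fs_cong G A (subst u) (subst v)"
proof (induction rule: fs_cong.induct)
  case (swap_right g1 g2)
  let ?c = "inv g2 \<otimes> g1 \<otimes> g2"
  have c: "?c \<in> B" using swap_right source.conj_closed_inv by blast
  have g: "g1 \<in> carrier G" "g2 \<in> carrier G" using swap_right source.subset_carrier by auto
  have "conj_elt G g2 ?c = g1" using g by (simp add: conj_elt_def m_assoc cancel_left)
  then have "subst [g1, g2] \<approx> subst [g2, ?c]"
    using heq_sym[OF subst_swap[OF swap_right(2) c]] by simp
  moreover have "subst [g1, g2] \<noteq> []"
    using length_subst[of "[g1, g2]"] W_nonempty by (metis length_0_conv list.distinct(1) mult_is_0)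
  ultimately show ?case by (auto intro: heq_nonempty)
next
  case (swap_left g1 g2)
  have "subst [g1, g2] \<noteq> []"
    using length_subst[of "[g1, g2]"] W_nonempty by (metis length_0_conv list.distinct(1) mult_is_0)
  then show ?case
    using heq_nonempty[OF subst_swap[OF swap_left]] by (simp add: conj_elt_def)
next
  case (unit g)
  then show ?case using one_notin_B by simp
next
  case (refl w)
  then show ?case by (intro fs_cong.refl subst_words)
next
  case (append u u' v v')
  then show ?case by (simp add: fs_cong.append)
qed (blast intro: fs_cong.sym fs_cong.trans)+

definition subst_class :: "'a list set \<Rightarrow> 'a list set" where
  "subst_class s = (\<Union>u\<in>s. fs_rel G A `` {subst u})"

lemma subst_class_class:
  assumes "u \<in> fs_words B"
  shows "subst_class (fs_rel G B `` {u}) = fs_rel G A `` {subst u}"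
proof -
  have "fs_rel G A `` {subst v} = fs_rel G A `` {subst u}" if "v \<in> fs_rel G B `` {u}" for v
    using that fs_class_eq[OF subst_cong[of u v]] by (simp add: fs_rel_def)
  moreover have "u \<in> fs_rel G B `` {u}"
    using fs_cong.refl[OF assms, of G] by (simp add: fs_rel_def)
  ultimately show ?thesis unfolding subst_class_def by blast
qed

lemma subst_class_in: "s \<in> full_fact_semigroup G B \<Longrightarrow> subst_class s \<in> fact_semigroup G A"
  by (elim source.full_fact_semigroupE)
    (auto simp: subst_class_class fact_semigroup_def intro: quotientI subst_words)

lemma subst_class_mult:
  assumes "s \<in> full_fact_semigroup G B" "s' \<in> full_fact_semigroup G B"
  shows "subst_class (fs_mult G B s s') = fs_mult G A (subst_class s) (subst_class s')"
proof -
  obtain u v where u: "u \<in> fs_words B" "s = fs_rel G B `` {u}"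
    and v: "v \<in> fs_words B" "s' = fs_rel G B `` {v}"
    using assms by (auto elim!: source.full_fact_semigroupE)
  have "u @ v \<in> fs_words B" using u v by (auto simp: fs_words_def)
  then show ?thesis
    using u v by (simp add: source.fs_mult_class subst_class_class fs_mult_class subst_words)
qed

lemma subst_class_prod:
  assumes "s \<in> full_fact_semigroup G B"
  shows "fs_prod G (subst_class s) = fs_prod G s"
proof -
  obtain u where u: "u \<in> fs_words B" "s = fs_rel G B `` {u}"
    using assms by (auto elim!: source.full_fact_semigroupE)
  then show ?thesis
    using subst_prod[of u]
    by (simp add: source.fs_prod_class subst_class_class fs_prod_class subst_words)
      (simp add: fs_words_def)
qed

lemma subst_class_act:
  assumes "g \<in> carrier G" "s \<in> full_fact_semigroup G B"
  shows "subst_class (fs_act G B g s) = fs_act G A g (subst_class s)"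
proof -
  obtain u where u: "u \<in> fs_words B" "s = fs_rel G B `` {u}"
    using assms by (auto elim!: source.full_fact_semigroupE)
  have gu: "conj_word g u \<in> fs_words B"
    using u assms(1) source.conj_closed by (auto simp: fs_words_def)
  have "conj_word g (subst u) \<approx> subst (conj_word g u)"
    using u assms(1) by (intro conj_subst) (auto simp: fs_words_def)
  then have "fs_cong G A (conj_word g (subst u)) (subst (conj_word g u))"
    using subst_words[OF gu] by (intro heq_nonempty) (auto simp: fs_words_def)
  then show ?thesis
    using u gu assms(1) fs_class_eq
    by (simp add: source.fs_act_class subst_class_class fs_act_class subst_words)
qed

text \<open>Product and length of an image determine product and length of the original word, since every
  letter is replaced by a word of one and the same positive length.\<close>

lemma inj_on_subst_class:
  assumes one_notin_A: "\<one> \<notin> A"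
    and separated: "\<And>u v. \<lbrakk>u \<in> fs_words B; v \<in> fs_words B; generate G (set u) = carrier G;
        generate G (set v) = carrier G; word_prod u = word_prod v; length u = length v\<rbrakk>
      \<Longrightarrow> fs_cong G B u v"
  shows "inj_on subst_class (full_fact_semigroup G B)"
proof (rule inj_onI)
  fix s s' assume s: "s \<in> full_fact_semigroup G B" and s': "s' \<in> full_fact_semigroup G B"
    and eq: "subst_class s = subst_class s'"
  obtain u where u: "u \<in> fs_words B" "s = fs_rel G B `` {u}" "generate G (set u) = carrier G"
    using s by (rule source.full_fact_semigroupE)
  obtain v where v: "v \<in> fs_words B" "s' = fs_rel G B `` {v}" "generate G (set v) = carrier G"
    using s' by (rule source.full_fact_semigroupE)
  have "fs_cong G A (subst u) (subst v)"
    using eq u v subst_words by (intro class_eqD) (simp_all add: subst_class_class)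
  then have "length (subst u) = length (subst v)" "word_prod (subst u) = word_prod (subst v)"
    using fs_cong_length[OF one_notin_A] fs_cong_prod by auto
  then have "length u = length v" "word_prod u = word_prod v"
    using u v W_nonempty subst_prod[of u] subst_prod[of v] by (auto simp: length_subst fs_words_def)
  then show "s = s'" using separated u v source.fs_class_eq by simp
qed

end

section \<open>Words of transpositions with equal product and length\<close>

definition transps :: "nat set \<Rightarrow> (nat \<Rightarrow> nat) set" where
  "transps X = {Transposition.transpose i j | i j. i \<in> X \<and> j \<in> X \<and> i \<noteq> j}"

definition star :: "nat \<Rightarrow> nat set \<Rightarrow> (nat \<Rightarrow> nat) set" where
  "star p X = Transposition.transpose p ` (X - {p})"

definition stable :: "(nat \<Rightarrow> nat) list \<Rightarrow> nat set \<Rightarrow> bool" where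
  "stable u Y \<longleftrightarrow> (\<forall>\<tau>\<in>set u. \<forall>y\<in>Y. \<tau> y \<in> Y)"

text \<open>Regarding transpositions as edges, this is connectedness of a graph on \<open>X\<close>. Stated through
  stable subsets it is visibly a property of the generated group, hence invariant under Hurwitz
  moves.\<close>

definition connected :: "(nat \<Rightarrow> nat) list \<Rightarrow> nat set \<Rightarrow> bool" where
  "connected u X \<longleftrightarrow> (\<forall>Y\<subseteq>X. stable u Y \<longrightarrow> Y = {} \<or> Y = X)"

lemma transpositions_eq: "transpositions d = transps {1..d}"
  by (auto simp: transpositions_def transps_def)

lemma transps_mono: "X \<subseteq> Y \<Longrightarrow> transps X \<subseteq> transps Y"
  by (auto simp: transps_def)

lemma star_subset_transps: "p \<in> X \<Longrightarrow> star p X \<subseteq> transps X"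
  by (auto simp: transps_def star_def)

lemma transps_cases: "\<tau> \<in> transps X \<Longrightarrow> p \<in> X \<Longrightarrow> \<tau> \<in> transps (X - {p}) \<or> \<tau> \<in> star p X"
proof -
  assume "\<tau> \<in> transps X" "p \<in> X"
  then obtain i j where "i \<in> X" "j \<in> X" "i \<noteq> j" "\<tau> = Transposition.transpose i j"
    "\<tau> = Transposition.transpose j i"
    by (auto simp: transps_def transpose_commute)
  then show ?thesis unfolding transps_def star_def by blast
qed

lemma transps_permutes: "\<tau> \<in> transps X \<Longrightarrow> \<tau> permutes X"
  by (auto simp: transps_def intro: permutes_swap_id)

lemma transps_fixes: "\<tau> \<in> transps (X - {p}) \<Longrightarrow> \<tau> p = p"
  by (auto simp: transps_def)

lemma transpose_conj:
  assumes "bij g"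
  shows "g \<circ> Transposition.transpose i j \<circ> inv' g = Transposition.transpose (g i) (g j)"
proof
  fix x
  obtain y where x: "x = g y" using assms by (metis bij_pointE)
  have "inj g" using assms by (rule bij_is_inj)
  then show "(g \<circ> Transposition.transpose i j \<circ> inv' g) x = Transposition.transpose (g i) (g j) x"
    by (auto simp: x Transposition.transpose_def inj_eq)
qed

locale symmetric_group = fixes d :: nat
begin

sublocale conj_invariant "sym_group d" "transpositions d"
  by (rule conj_invariant_transpositions)

notation heq (infix "\<approx>" 50)

lemma one_notin_transpositions: "\<one>\<^bsub>sym_group d\<^esub> \<notin> transpositions d"
  unfolding transpositions_def sym_group_one using transpose_eq_id_iff by fastforce

lemma inv_sym_group: "g \<in> carrier (sym_group d) \<Longrightarrow> inv\<^bsub>sym_group d\<^esub> g = inv' g"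
  by (intro inv_equality) (auto simp: sym_group_def permutes_inv permutes_inv_o)

lemma conj_elt_transpose:
  assumes "g \<in> carrier (sym_group d)"
  shows "conj_elt (sym_group d) g (Transposition.transpose i j) = Transposition.transpose (g i) (g j)"
proof -
  have "bij g" using assms permutes_bij by (auto simp: sym_group_carrier)
  then show ?thesis
    using assms by (simp add: conj_elt_def inv_sym_group sym_group_mult transpose_conj)
qed

lemma transpose_carrier:
  "i \<in> {1..d} \<Longrightarrow> j \<in> {1..d} \<Longrightarrow> Transposition.transpose i j \<in> carrier (sym_group d)"
  by (simp add: sym_group_carrier permutes_swap_id)

lemma transps_lists: "X \<subseteq> {1..d} \<Longrightarrow> u \<in> lists (transps X) \<Longrightarrow> u \<in> lists (transpositions d)"
  using transps_mono[of X "{1..d}"] by (auto simp: transpositions_eq)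

lemma word_prod_permutes:
  assumes "u \<in> lists (transps X)"
  shows "word_prod u permutes X"
  using assms
proof (induction u)
  case Nil
  then show ?case using permutes_id by (simp add: sym_group_one id_def)
next
  case (Cons \<tau> u)
  then have "word_prod u permutes X" "\<tau> permutes X" using transps_permutes by auto
  then have "\<tau> \<circ> word_prod u permutes X" by (rule permutes_compose)
  moreover have "word_prod (\<tau> # u) = \<tau> \<circ> word_prod u" by (simp add: sym_group_mult)
  ultimately show ?case by (simp only:)
qed

lemma leaf_transposition:
  assumes "X \<subseteq> {1..d}" "p \<in> X" "i \<in> X - {p}"
  shows "Transposition.transpose p i \<in> transpositions d"
  using assms star_subset_transps[OF assms(2)] transps_mono[OF assms(1)]
  unfolding transpositions_eq star_def by blast

lemma stable_generate:
  assumes "stable u Y" "u \<in> lists (transpositions d)" "g \<in> generate (sym_group d) (set u)" "y \<in> Y"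
  shows "g y \<in> Y"
  using assms(3,4)
proof (induction arbitrary: y rule: generate.induct)
  case (inv h)
  then have "h \<in> transpositions d" using assms(2) by auto
  then have "h \<in> carrier (sym_group d)" "inv' h = h"
    using subset_carrier by (auto simp: transpositions_def)
  then show ?case using inv assms(1) by (simp add: inv_sym_group stable_def)
qed (use assms(1) in \<open>auto simp: sym_group_one sym_group_mult stable_def\<close>)

lemma stable_heq:
  assumes "u \<approx> v" "stable u Y"
  shows "stable v Y"
  unfolding stable_def
proof (intro ballI)
  fix \<tau> y assume "\<tau> \<in> set v" "y \<in> Y"
  then have "\<tau> \<in> generate (sym_group d) (set u)"
    using heq_generate[OF assms(1)] by (simp add: generate.incl)
  then show "\<tau> y \<in> Y" using stable_generate assms heq_lists \<open>y \<in> Y\<close> by blast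
qed

lemma connected_heq: "u \<approx> v \<Longrightarrow> connected u X \<Longrightarrow> connected v X"
  using stable_heq heq_sym unfolding connected_def by blast

lemma connected_generate:
  assumes "u \<in> lists (transpositions d)" "generate (sym_group d) (set u) = carrier (sym_group d)"
  shows "connected u {1..d}"
  unfolding connected_def
proof (intro allI impI, rule ccontr)
  fix Y assume Y: "Y \<subseteq> {1..d}" "stable u Y" "\<not> (Y = {} \<or> Y = {1..d})"
  then obtain x y where "y \<in> Y" "x \<in> {1..d}" "x \<notin> Y" by blast
  moreover from this have "Transposition.transpose y x \<in> generate (sym_group d) (set u)"
    using Y(1) by (auto simp: assms(2) intro!: transpose_carrier)
  ultimately show False using stable_generate[OF Y(2) assms(1), of _ y] by fastforce
qed

text \<open>Letters moving \<open>p\<close> can be pushed to the right: jumping over a permutation that fixes \<open>p\<close> turns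
  \<open>(p i)\<close> into some \<open>(p j)\<close>.\<close>

lemma split_star:
  assumes X: "X \<subseteq> {1..d}" and p: "p \<in> X" and u: "u \<in> lists (transps X)"
  obtains v w where "v \<in> lists (transps (X - {p}))" "w \<in> lists (star p X)" "u \<approx> v @ w"
    "length w = length (filter (\<lambda>\<tau>. \<tau> p \<noteq> p) u)"
  using u
proof (induction u arbitrary: thesis)
  case Nil
  show ?case by (rule Nil.prems(1)[of "[]" "[]"]) auto
next
  case (Cons \<tau> u)
  then obtain v w where v: "v \<in> lists (transps (X - {p}))" and w: "w \<in> lists (star p X)"
    and u: "u \<approx> v @ w" and len: "length w = length (filter (\<lambda>\<tau>. \<tau> p \<noteq> p) u)"
    by auto
  have X': "X - {p} \<subseteq> {1..d}" using X by blast
  have \<tau>: "\<tau> \<in> transps X" "\<tau> \<in> transpositions d" using Cons transps_lists[OF X, of "[\<tau>]"] by auto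
  have vT: "v \<in> lists (transpositions d)" by (rule transps_lists[OF X' v])
  have wT: "w \<in> lists (transpositions d)"
    using w star_subset_transps[OF p] by (intro transps_lists[OF X]) auto
  have step: "\<tau> # u \<approx> [\<tau>] @ v @ w" using heq_append[OF heq_refl u, of "[\<tau>]"] \<tau> by simp
  from transps_cases[OF \<tau>(1) p] show ?case
  proof
    assume *: "\<tau> \<in> transps (X - {p})"
    then have "\<tau> p = p" by (rule transps_fixes)
    then show ?thesis using * step v w len by (intro Cons.prems(1)[of "\<tau> # v" w]) auto
  next
    assume *: "\<tau> \<in> star p X"
    then obtain i where i: "i \<in> X - {p}" "\<tau> = Transposition.transpose p i" by (auto simp: star_def)
    let ?g = "inv\<^bsub>sym_group d\<^esub> (word_prod v)"
    let ?c = "conj_elt (sym_group d) ?g \<tau>"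
    have c: "?g \<in> carrier (sym_group d)" by (intro inv_closed word_prod_closed vT)
    have "?g = inv' (word_prod v)" using vT word_prod_closed by (simp add: inv_sym_group)
    then have g: "?g permutes (X - {p})" using v by (simp add: permutes_inv word_prod_permutes)
    then have "?g p = p" by (simp add: permutes_not_in)
    then have "?c = Transposition.transpose p (?g i)" using c i by (simp add: conj_elt_transpose)
    moreover have "?g i \<in> X - {p}" using g i permutes_in_image by metis
    ultimately have cs: "?c \<in> star p X" by (auto simp: star_def)
    have "[\<tau>] @ v \<approx> v @ [?c]" using word_past_word_back[of "[\<tau>]" v] \<tau> vT by simp
    then have "([\<tau>] @ v) @ w \<approx> (v @ [?c]) @ w" using wT by (rule heq_append[OF _ heq_refl])
    then have "\<tau> # u \<approx> v @ ?c # w" using heq_trans[OF step] by simp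
    moreover have "\<tau> p \<noteq> p" using i by auto
    ultimately show ?thesis using v w cs len by (intro Cons.prems(1)[of v "?c # w"]) auto
  qed
qed

end

lemma adjacent_distinct_or_replicate:
  "(\<exists>w1 a b w2. w = w1 @ a # b # w2 \<and> a \<noteq> b) \<or> w = replicate (length w) (hd w)"
proof (induction w)
  case (Cons a w)
  show ?case
  proof (cases w)
    case (Cons b w')
    show ?thesis
    proof (cases "a = b")
      case False
      then have "a # w = [] @ a # b # w' \<and> a \<noteq> b" using Cons by simp
      then show ?thesis by blast
    next
      case True
      from Cons.IH show ?thesis
      proof
        assume "\<exists>w1 a b w2. w = w1 @ a # b # w2 \<and> a \<noteq> b"
        then obtain w1 c e w2 where "w = w1 @ c # e # w2" "c \<noteq> e" by blast
        then have "a # w = (a # w1) @ c # e # w2 \<and> c \<noteq> e" by simp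
        then show ?thesis by blast
      qed (use Cons True in auto)
    qed
  qed simp
qed simp

context symmetric_group
begin

text \<open>For distinct neighbours, \<open>(p i) (p j)\<close> is equivalent to \<open>(i j) (p i)\<close>, where one letter less moves
  \<open>p\<close>.\<close>

lemma star_reduce:
  assumes X: "X \<subseteq> {1..d}" and p: "p \<in> X" and v: "v \<in> lists (transps (X - {p}))"
    and w: "w \<in> lists (star p X)" and neq: "w \<noteq> replicate (length w) (hd w)"
  obtains u where "u \<in> lists (transps X)" "v @ w \<approx> u"
    "length (filter (\<lambda>\<tau>. \<tau> p \<noteq> p) u) < length w"
proof -
  obtain w1 a b w2 where ab: "w = w1 @ a # b # w2" "a \<noteq> b"
    using adjacent_distinct_or_replicate[of w] neq by blast
  obtain i j where ij: "i \<in> X - {p}" "j \<in> X - {p}" "a = Transposition.transpose p i"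
    "b = Transposition.transpose p j" using w ab by (auto simp: star_def)
  let ?c = "conj_elt (sym_group d) a b"
  have ws: "w \<in> lists (transps X)" using w star_subset_transps[OF p] by auto
  have vs: "v \<in> lists (transps X)" using v transps_mono[of "X - {p}" X] by auto
  have T: "v \<in> lists (transpositions d)" "w \<in> lists (transpositions d)"
    using transps_lists[OF X] vs ws by auto
  have "a \<in> carrier (sym_group d)" using X p ij by (auto intro!: transpose_carrier)
  moreover have neq: "i \<noteq> j" using ij ab(2) by auto
  ultimately have c: "?c = Transposition.transpose i j" using ij by (simp add: conj_elt_transpose)
  have cs: "?c \<in> transps X" "?c p = p" using ij(1,2) neq unfolding c by (auto simp: transps_def)
  have "[a, b] \<approx> [?c, a]" using letter_past_word[of a "[b]"] T ab by simp
  let ?u = "(v @ w1) @ [?c, a] @ w2"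
  have "(v @ w1) @ [a, b] @ w2 \<approx> ?u"
    using T ab \<open>[a, b] \<approx> [?c, a]\<close> by (intro heq_context) auto
  then have "v @ w \<approx> ?u" by (simp only: ab append_assoc append_Cons append_Nil)
  moreover have "?u \<in> lists (transps X)" using vs ws cs ab by auto
  moreover have "filter (\<lambda>\<tau>. \<tau> p \<noteq> p) v = []"
    using v by (auto simp: filter_empty_conv in_lists_conv_set transps_fixes)
  then have "length (filter (\<lambda>\<tau>. \<tau> p \<noteq> p) ?u) < length w"
    using cs(2) length_filter_le[of "\<lambda>\<tau>. \<tau> p \<noteq> p" w1]
      length_filter_le[of "\<lambda>\<tau>. \<tau> p \<noteq> p" w2]
    by (simp add: ab del: length_filter_le)
  ultimately show ?thesis using that by blast
qed

text \<open>The square of \<open>(p i)\<close> is central, so it can be placed next to any letter \<open>\<tau>\<close> of \<open>v\<close>; jumping over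
  \<open>\<tau>\<close> it becomes the square of \<open>(p \<tau>(i))\<close>. The reachable points form a stable set, which is all of \<open>X - {p}\<close>
  by connectedness.\<close>

lemma move_square:
  assumes X: "X \<subseteq> {1..d}" and p: "p \<in> X" and v: "v \<in> lists (transps (X - {p}))"
    and con: "connected v (X - {p})" and ij: "i \<in> X - {p}" "j \<in> X - {p}"
  shows "v @ [Transposition.transpose p i, Transposition.transpose p i]
      \<approx> v @ [Transposition.transpose p j, Transposition.transpose p j]"
proof -
  let ?s = "\<lambda>j. [Transposition.transpose p j, Transposition.transpose p j]"
  have X': "X - {p} \<subseteq> {1..d}" using X by blast
  have vT: "v \<in> lists (transpositions d)" by (rule transps_lists[OF X' v])
  have s: "?s j \<in> lists (transpositions d)" "word_prod (?s j) = \<one>\<^bsub>sym_group d\<^esub>"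
    if "j \<in> X - {p}" for j
    using leaf_transposition[OF X p that] by (auto simp: sym_group_mult sym_group_one)
  define Y where "Y = {j \<in> X - {p}. v @ ?s i \<approx> v @ ?s j}"
  have "stable v Y"
    unfolding stable_def
  proof (intro ballI)
    fix \<tau> j assume \<tau>: "\<tau> \<in> set v" and "j \<in> Y"
    then have j: "j \<in> X - {p}" "v @ ?s i \<approx> v @ ?s j" by (auto simp: Y_def)
    have \<tau>X: "\<tau> \<in> transps (X - {p})" using \<tau> v by (auto simp: in_lists_conv_set)
    then have \<tau>p: "\<tau> permutes (X - {p})" by (rule transps_permutes)
    then have \<tau>j: "\<tau> j \<in> X - {p}" "\<tau> p = p"
      using j(1) permutes_in_image[OF \<tau>p, of j] transps_fixes[OF \<tau>X] by blast+
    have \<tau>T: "\<tau> \<in> transpositions d" using \<tau> vT by (auto simp: in_lists_conv_set)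
    then have "\<tau> \<in> carrier (sym_group d)" using subset_carrier by auto
    then have conj: "conj_word \<tau> (?s j) = ?s (\<tau> j)" using \<tau>j by (simp add: conj_elt_transpose)
    obtain v1 v2 where v12: "v = v1 @ \<tau> # v2" using \<tau> split_list by fast
    have l: "v1 \<in> lists (transpositions d)" "v2 \<in> lists (transpositions d)"
      using vT unfolding v12 by auto
    have "v @ ?s j = (v1 @ [\<tau>]) @ v2 @ ?s j" by (simp add: v12)
    also have "\<dots> \<approx> (v1 @ [\<tau>]) @ ?s j @ v2"
      using l \<tau>T heq_sym[OF central_word[OF s(1)[OF j(1)] l(2) s(2)[OF j(1)]]]
      by (intro heq_append[OF heq_refl]) auto
    also have "\<dots> = v1 @ ([\<tau>] @ ?s j) @ v2" by simp
    also have "\<dots> \<approx> v1 @ (?s (\<tau> j) @ [\<tau>]) @ v2"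
      using letter_past_word[OF \<tau>T s(1)[OF j(1)]] l unfolding conj by (intro heq_context) simp_all
    also have "\<dots> = v1 @ (?s (\<tau> j) @ (\<tau> # v2))" by simp
    also have "\<dots> \<approx> v1 @ ((\<tau> # v2) @ ?s (\<tau> j))"
      using l \<tau>T by (intro heq_append[OF heq_refl] central_word[OF s(1)[OF \<tau>j(1)] _ s(2)[OF \<tau>j(1)]]) auto
    also have "\<dots> = v @ ?s (\<tau> j)" by (simp add: v12)
    finally have "v @ ?s i \<approx> v @ ?s (\<tau> j)" by (rule heq_trans[OF j(2)])
    then show "\<tau> j \<in> Y" using \<tau>j by (simp add: Y_def)
  qed
  moreover have "v @ ?s i \<approx> v @ ?s i" using vT s(1)[OF ij(1)] by (intro heq_refl) simp
  then have "i \<in> Y" using ij(1) unfolding Y_def by blast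
  moreover have "Y \<subseteq> X - {p}" unfolding Y_def by blast
  ultimately have "Y = X - {p}" using con unfolding connected_def by blast
  then have "j \<in> Y" using ij(2) by simp
  then show ?thesis unfolding Y_def by blast
qed

text \<open>In the graph whose edges are the letters of \<open>v @ w\<close>, the vertex \<open>p\<close> is a leaf attached to \<open>i\<close>.\<close>

lemma connected_remove_leaf:
  assumes con: "connected (v @ w) X" and p: "p \<in> X"
    and v: "v \<in> lists (transps (X - {p}))"
    and w: "set w \<subseteq> {Transposition.transpose p i}" and i: "i \<in> X - {p}"
  shows "connected v (X - {p})"
  unfolding connected_def
proof (intro allI impI)
  fix Y assume Y: "Y \<subseteq> X - {p}" "stable v Y"
  have vp: "\<tau> p = p" if "\<tau> \<in> set v" for \<tau>
    using that v by (auto simp: in_lists_conv_set intro: transps_fixes)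
  have wt: "\<tau> = Transposition.transpose p i" if "\<tau> \<in> set w" for \<tau> using that w by blast
  show "Y = {} \<or> Y = X - {p}"
  proof (cases "i \<in> Y")
    case True
    have "stable (v @ w) (insert p Y)"
      using Y(2) True vp by (auto simp: stable_def Transposition.transpose_def dest!: wt split: if_splits)
    then show ?thesis using con Y p unfolding connected_def by blast
  next
    case False
    have "stable (v @ w) Y"
      using Y False by (auto simp: stable_def Transposition.transpose_def dest!: wt)
    then show ?thesis using con Y p unfolding connected_def by blast
  qed
qed

text \<open>Take an equivalent word with as few letters moving \<open>p\<close> as possible and collect these letters at
  the end. By minimality no two distinct ones can be neighbours, so they are \<open>n\<close> copies of a single
  \<open>(p i)\<close>. For \<open>n \<ge> 3\<close> the first two copies could be turned into copies of another \<open>(p j)\<close>, which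
  produces distinct neighbours. The other point \<open>j\<close> is where \<open>card X \<ge> 3\<close> enters.\<close>

lemma normal_form:
  assumes X: "X \<subseteq> {1..d}" and p: "p \<in> X" and card: "card X \<ge> 3"
    and u: "u \<in> lists (transps X)" and con: "connected u X"
  obtains v i where "v \<in> lists (transps (X - {p}))" "connected v (X - {p})" "i \<in> X - {p}"
    "u \<approx> v @ [Transposition.transpose p i]
      \<or> u \<approx> v @ [Transposition.transpose p i, Transposition.transpose p i]"
proof -
  let ?cnt = "\<lambda>u. length (filter (\<lambda>\<tau>. \<tau> p \<noteq> p) u)"
  have uT: "u \<in> lists (transpositions d)" using transps_lists X u by blast
  define P where "P = (\<lambda>u'. u' \<in> lists (transps X) \<and> u \<approx> u')"
  have "P u" using u uT by (auto simp: P_def)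
  then obtain u' where u': "P u'" and min: "\<And>u''. P u'' \<Longrightarrow> ?cnt u' \<le> ?cnt u''"
    using ex_has_least_nat[of P u ?cnt] by blast
  obtain v w where v: "v \<in> lists (transps (X - {p}))" and w: "w \<in> lists (star p X)"
    and u'vw: "u' \<approx> v @ w" and len: "length w = ?cnt u'"
    using split_star[OF X p, of u'] u' by (auto simp: P_def)
  have uvw: "u \<approx> v @ w" using u' heq_trans[OF _ u'vw] by (simp add: P_def)
  have const: "w' = replicate (length w') (hd w')"
    if w': "w' \<in> lists (star p X)" "u \<approx> v @ w'" "length w' = length w" for w'
  proof (rule ccontr)
    assume neq: "w' \<noteq> replicate (length w') (hd w')"
    then obtain u'' where "u'' \<in> lists (transps X)" "v @ w' \<approx> u''" "?cnt u'' < length w'"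
      using star_reduce[OF X p v w'(1) neq] by blast
    moreover from this have "P u''" using heq_trans[OF w'(2)] by (simp add: P_def)
    ultimately show False using min len w'(3) by fastforce
  qed
  obtain n a where wn: "w = replicate n a" using const[OF w uvw HOL.refl] by blast
  have con': "connected (v @ w) X" using connected_heq[OF uvw con] .
  have "n \<noteq> 0"
  proof
    assume "n = 0"
    then have "stable (v @ w) {p}"
      using v by (auto simp: wn stable_def in_lists_conv_set intro: transps_fixes)
    then have "X = {p}" using con' p unfolding connected_def by blast
    then show False using card by simp
  qed
  then have "a \<in> star p X" using w by (simp add: wn in_lists_conv_set)
  then obtain i where i: "i \<in> X - {p}" "a = Transposition.transpose p i" by (auto simp: star_def)
  have "set w \<subseteq> {Transposition.transpose p i}" by (simp add: wn i(2) set_replicate_conv_if)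
  then have conv: "connected v (X - {p})" by (rule connected_remove_leaf[OF con' p v _ i(1)])
  have "n < 3"
  proof (rule ccontr)
    assume "\<not> n < 3"
    then have "w = a # a # a # replicate (n - 3) a"
      by (simp add: wn flip: replicate_Suc)
    then obtain m where w_eq: "w = a # a # a # replicate m a" by blast
    have "finite X" using X finite_subset by blast
    then have "\<not> X \<subseteq> {p, i}" using card card_mono[of "{p, i}" X] by (auto simp: card_insert_if split: if_splits)
    then obtain j where j: "j \<in> X - {p}" "j \<noteq> i" by blast
    let ?b = "Transposition.transpose p j"
    have l: "a # replicate m a \<in> lists (transpositions d)"
      using leaf_transposition[OF X p i(1)] i(2) by auto
    have "(v @ [a, a]) @ a # replicate m a \<approx> (v @ [?b, ?b]) @ a # replicate m a"
      using heq_append[OF move_square[OF X p v conv i(1) j(1)] heq_refl[OF l]] i(2) by simp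
    then have "v @ w \<approx> v @ (?b # ?b # a # replicate m a)" by (simp add: w_eq)
    with uvw have "u \<approx> v @ (?b # ?b # a # replicate m a)" by (rule heq_trans)
    moreover have "?b # ?b # a # replicate m a \<in> lists (star p X)"
      using j i by (auto simp: star_def)
    moreover have "length (?b # ?b # a # replicate m a) = length w" by (simp add: w_eq)
    ultimately have "?b # ?b # a # replicate m a = replicate (length w) ?b"
      using const[of "?b # ?b # a # replicate m a"] by simp
    then have "?b = a" by (simp add: w_eq)
    then show False using j i by (metis transpose_apply_first)
  qed
  then have "n = 1 \<or> n = 2" using \<open>n \<noteq> 0\<close> by linarith
  then have "w = [a] \<or> w = [a, a]" by (auto simp: wn numeral_2_eq_2)
  then have "u \<approx> v @ [Transposition.transpose p i]
      \<or> u \<approx> v @ [Transposition.transpose p i, Transposition.transpose p i]"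
    using uvw i(2) by auto
  then show ?thesis using that v conv i(1) by blast
qed

text \<open>This is the classical theorem of Clebsch and Hurwitz. The induction removes one point \<open>p\<close>. In the
  normal form the product \<open>\<pi>\<close> fixes \<open>p\<close> exactly when there are two letters \<open>(p i)\<close>; in that case \<open>i\<close>
  is arbitrary, and otherwise \<open>i = \<pi>\<^sup>-\<^sup>1(p)\<close>. So the product determines the part of the word moving
  \<open>p\<close>, and with it the product and the length of the rest.\<close>

theorem transposition_words_equivalent:
  assumes "X \<subseteq> {1..d}"
    and "u \<in> lists (transps X)" "v \<in> lists (transps X)" "connected u X" "connected v X"
    and "word_prod u = word_prod v" "length u = length v"
  shows "u \<approx> v"
  using assms
proof (induction "card X" arbitrary: X u v rule: less_induct)
  case less
  have fin: "finite X" using less.prems(1) finite_subset by blast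
  show ?case
  proof (cases "card X \<ge> 3")
    case False
    have "\<tau> = \<tau>'" if \<tau>: "\<tau> \<in> transps X" "\<tau>' \<in> transps X" for \<tau> \<tau>'
    proof -
      obtain i j where ij: "i \<in> X" "j \<in> X" "i \<noteq> j" "\<tau> = Transposition.transpose i j"
        using \<tau>(1) unfolding transps_def by blast
      then have "X = {i, j}" using False fin card_seteq[of X "{i, j}"] by simp
      then show ?thesis using \<tau>(2) ij by (auto simp: transps_def transpose_commute)
    qed
    \<comment> \<open>At most one letter is available, so the length determines the word.\<close>
    then have "u = v" using less.prems
      by (intro nth_equalityI) (auto simp: in_lists_conv_set)
    then show ?thesis using less.prems transps_lists by blast
  next
    case True
    then obtain p where p: "p \<in> X" by fastforce
    let ?t = "Transposition.transpose p"
    have X': "X - {p} \<subseteq> {1..d}" using less.prems(1) by blast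
    have lt: "card (X - {p}) < card X" using p fin by (meson card_Diff1_less)
    obtain v1 i where 1: "v1 \<in> lists (transps (X - {p}))" "connected v1 (X - {p})" "i \<in> X - {p}"
      "u \<approx> v1 @ [?t i] \<or> u \<approx> v1 @ [?t i, ?t i]"
      using normal_form[OF less.prems(1) p True less.prems(2,4)] by blast
    obtain v2 j where 2: "v2 \<in> lists (transps (X - {p}))" "connected v2 (X - {p})" "j \<in> X - {p}"
      "v \<approx> v2 @ [?t j] \<or> v \<approx> v2 @ [?t j, ?t j]"
      using normal_form[OF less.prems(1) p True less.prems(3,5)] by blast
    have T: "?t i \<in> transpositions d" if "i \<in> X - {p}" for i
      using leaf_transposition[OF less.prems(1) p that] .
    have single: "word_prod v' permutes (X - {p})" "word_prod (v' @ [?t i]) = word_prod v' \<circ> ?t i"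
        "word_prod (v' @ [?t i, ?t i]) = word_prod v'"
      if v': "v' \<in> lists (transps (X - {p}))" and i: "i \<in> X - {p}" for v' i
    proof -
      show "word_prod v' permutes (X - {p})" using v' by (rule word_prod_permutes)
      have vT: "v' \<in> lists (transpositions d)" using transps_lists[OF X' v'] .
      show "word_prod (v' @ [?t i]) = word_prod v' \<circ> ?t i"
        using vT T[OF i] by (subst word_prod_append) (auto simp: sym_group_mult sym_group_one)
      show "word_prod (v' @ [?t i, ?t i]) = word_prod v'"
        using vT T[OF i] by (subst word_prod_append) (auto simp: sym_group_mult sym_group_one)
    qed
    note s1 = single[OF 1(1,3)] and s2 = single[OF 2(1,3)]
    have len: "length u = length u'" if "u \<approx> u'" for u u'
    proof -
      show ?thesis
        using that fs_cong_length[OF one_notin_transpositions] by (auto simp: heq_def)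
    qed
    \<comment> \<open>Whether the product fixes \<open>p\<close> tells the two normal forms apart.\<close>
    have moved: "(word_prod v' \<circ> ?t i) p \<noteq> p"
      if "word_prod v' permutes (X - {p})" "i \<in> X - {p}" for v' i
      using permutes_in_image[OF that(1), of i] that(2) by auto
    have fixed: "word_prod v' p = p" if "word_prod v' permutes (X - {p})" for v'
      using that by (simp add: permutes_not_in)
    show ?thesis
    proof (cases "word_prod u p = p")
      case True
      then have u: "u \<approx> v1 @ [?t i, ?t i]"
        using 1(4) moved[OF s1(1) 1(3)] s1(2) heq_prod by metis
      have v: "v \<approx> v2 @ [?t j, ?t j]"
        using True less.prems(6) 2(4) moved[OF s2(1) 2(3)] s2(2) heq_prod by metis
      have "word_prod v1 = word_prod v2"
        using less.prems(6) heq_prod[OF u] heq_prod[OF v] s1(3) s2(3) by simp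
      moreover have "length v1 = length v2" using less.prems(7) len[OF u] len[OF v] by simp
      ultimately have "v1 \<approx> v2" using less.hyps[OF lt X'] 1 2 by blast
      then have "v1 @ [?t j, ?t j] \<approx> v2 @ [?t j, ?t j]"
        using T[OF 2(3)] by (intro heq_append heq_refl) auto
      moreover have "v1 @ [?t i, ?t i] \<approx> v1 @ [?t j, ?t j]"
        using move_square[OF less.prems(1) p 1(1,2,3) 2(3)] .
      ultimately show ?thesis using u v heq_trans heq_sym by meson
    next
      case False
      then have u: "u \<approx> v1 @ [?t i]"
        using 1(4) fixed[OF s1(1)] s1(3) heq_prod by metis
      have v: "v \<approx> v2 @ [?t j]"
        using False less.prems(6) 2(4) fixed[OF s2(1)] s2(3) heq_prod by metis
      have eq: "word_prod v1 \<circ> ?t i = word_prod v2 \<circ> ?t j"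
        using less.prems(6) heq_prod[OF u] heq_prod[OF v] s1(2) s2(2) by simp
      \<comment> \<open>The leaf is the preimage of \<open>p\<close> under the product.\<close>
      have "(word_prod v1 \<circ> ?t i) i = p" "(word_prod v2 \<circ> ?t j) j = p"
        using fixed s1(1) s2(1) by simp_all
      moreover have "inj (word_prod v1 \<circ> ?t i)"
        using permutes_inj[OF s1(1)] by (simp add: inj_compose)
      ultimately have ij: "i = j" using eq by (metis injD)
      have "word_prod v1 = word_prod v1 \<circ> ?t i \<circ> ?t i" by (simp add: o_assoc[symmetric])
      also have "\<dots> = word_prod v2" unfolding eq by (simp add: ij o_assoc[symmetric])
      finally have "word_prod v1 = word_prod v2" .
      moreover have "length v1 = length v2" using less.prems(7) len[OF u] len[OF v] by simp
      ultimately have "v1 \<approx> v2" using less.hyps[OF lt X'] 1 2 by blast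
      then have "v1 @ [?t i] \<approx> v2 @ [?t j]"
        unfolding ij using T[OF 2(3)] by (intro heq_append heq_refl) auto
      then show ?thesis using u v heq_trans heq_sym by meson
    qed
  qed
qed

section \<open>The centralizer of a transposition\<close>

lemma permutation_two_points:
  assumes "x \<in> S" "y \<in> S" "x \<noteq> y" "x' \<in> S" "y' \<in> S" "x' \<noteq> (y' :: nat)"
  obtains g where "g permutes S" "g x = x'" "g y = y'"
proof
  let ?t = "Transposition.transpose x x'"
  let ?g = "Transposition.transpose (?t y) y' \<circ> ?t"
  have "?t y \<in> S" "?t y \<noteq> x'" using assms by (auto simp: Transposition.transpose_def)
  then show "?g permutes S" "?g x = x'" "?g y = y'"
    using assms by (auto intro!: permutes_compose permutes_swap_id)
qed

lemma transpositions_conj_class: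
  assumes "i \<in> {1..d}" "j \<in> {1..d}" "i \<noteq> j"
  shows "transpositions d = conj_class (sym_group d) (Transposition.transpose i j)"
proof
  show "transpositions d \<subseteq> conj_class (sym_group d) (Transposition.transpose i j)"
  proof
    fix \<tau> assume "\<tau> \<in> transpositions d"
    then obtain k l where kl: "k \<in> {1..d}" "l \<in> {1..d}" "k \<noteq> l" "\<tau> = Transposition.transpose k l"
      by (auto simp: transpositions_def)
    obtain g where "g permutes {1..d}" "g i = k" "g j = l"
      using permutation_two_points[OF assms kl(1,2,3)] .
    then show "\<tau> \<in> conj_class (sym_group d) (Transposition.transpose i j)"
      using kl(4) unfolding conj_class_def
      by (intro image_eqI[of _ _ g]) (simp_all add: sym_group_carrier conj_elt_transpose)
  qed
  have "Transposition.transpose i j \<in> transpositions d"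
    using assms unfolding transpositions_def by blast
  then show "conj_class (sym_group d) (Transposition.transpose i j) \<subseteq> transpositions d"
    using conj_closed unfolding conj_class_def by blast
qed

text \<open>The centralizer of \<open>(i j)\<close> is generated by \<open>(i j)\<close> and the transpositions disjoint from it: an element
  fixes or exchanges \<open>i\<close> and \<open>j\<close>, and after multiplication by \<open>(i j)\<close> it fixes both.\<close>

lemma transposition_centralizer_induct:
  assumes h: "h \<in> carrier (sym_group d)"
      "conj_elt (sym_group d) h (Transposition.transpose i j) = Transposition.transpose i j"
    and ij: "i \<in> {1..d}" "j \<in> {1..d}" "i \<noteq> j"
    and one: "P id" and swap: "P (Transposition.transpose i j)"
    and disjoint: "\<And>k l. \<lbrakk>k \<in> {1..d} - {i, j}; l \<in> {1..d} - {i, j}; k \<noteq> l\<rbrakk>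
      \<Longrightarrow> P (Transposition.transpose k l)"
    and mult: "\<And>p q. \<lbrakk>p \<in> carrier (sym_group d); q \<in> carrier (sym_group d); P p; P q\<rbrakk> \<Longrightarrow> P (p \<circ> q)"
  shows "P h"
proof -
  let ?S = "{1..d} - {i, j}" and ?t = "Transposition.transpose i j"
  have perm: "h permutes {1..d}" using h by (simp add: sym_group_carrier)
  have t: "?t \<in> carrier (sym_group d)" using ij by (intro transpose_carrier)
  have both_fixed: "P q" if q: "q permutes {1..d}" "q i = i" "q j = j" for q
  proof -
    have "q permutes ?S" using q by (intro permutes_superset[OF q(1)]) auto
    moreover have "finite ?S" by simp
    ultimately show ?thesis
    proof (induction rule: permutes_induct)
      case (swap a b p)
      have "p permutes {1..d}" using swap by (auto intro: permutes_subset)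
      then show ?case
        using swap by (intro mult disjoint transpose_carrier) (auto simp: sym_group_carrier)
    qed (simp add: one flip: id_def)
  qed
  have "Transposition.transpose (h i) (h j) = ?t" using h by (simp add: conj_elt_transpose)
  then consider "h i = i" "h j = j" | "h i = j" "h j = i"
    using ij(3) transpose_apply_first transpose_apply_other by metis
  then show ?thesis
  proof cases
    case 1
    then show ?thesis using both_fixed perm 1 by blast
  next
    case 2
    have th: "?t \<circ> h permutes {1..d}" using t perm by (simp add: sym_group_carrier permutes_compose)
    then have "P (?t \<circ> h)" using 2 by (intro both_fixed) auto
    then have "P (?t \<circ> (?t \<circ> h))"
      using mult[OF t _ swap, of "?t \<circ> h"] th by (simp only: sym_group_carrier)
    moreover have "?t \<circ> (?t \<circ> h) = h" by (simp add: o_assoc)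
    ultimately show ?thesis by simp
  qed
qed

end

section \<open>The embedding\<close>

theorem theorem2:
  fixes d :: nat and \<sigma> :: "nat \<Rightarrow> nat" and C :: "(nat \<Rightarrow> nat) set"
    and i\<^sub>1 i\<^sub>2 :: nat and sbar :: "(nat \<Rightarrow> nat) list set"
  assumes "\<sigma> \<in> carrier (sym_group d)" and "\<not> evenperm \<sigma>"
    and "C = conj_class (sym_group d) \<sigma>"
    and "i\<^sub>1 \<in> {1..d}" and "i\<^sub>2 \<in> {1..d}" and "i\<^sub>1 \<noteq> i\<^sub>2"
    and "sbar \<in> fact_semigroup (sym_group d) C"
    and "fs_prod (sym_group d) sbar = Transposition.transpose i\<^sub>1 i\<^sub>2"
    and "\<exists>i\<^sub>3 \<in> {1..d} - {i\<^sub>1, i\<^sub>2}. \<exists>i\<^sub>4 \<in> {1..d} - {i\<^sub>1, i\<^sub>2}. i\<^sub>3 \<noteq> i\<^sub>4 \<and>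
           fs_act (sym_group d) C (Transposition.transpose i\<^sub>3 i\<^sub>4) sbar = sbar"
  shows "\<exists>\<phi> :: (nat \<Rightarrow> nat) list set \<Rightarrow> (nat \<Rightarrow> nat) list set.
      \<phi> \<in> full_fact_semigroup (sym_group d) (transpositions d) \<rightarrow> fact_semigroup (sym_group d) C \<and>
      inj_on \<phi> (full_fact_semigroup (sym_group d) (transpositions d)) \<and>
      (\<forall>s \<in> full_fact_semigroup (sym_group d) (transpositions d).
       \<forall>t \<in> full_fact_semigroup (sym_group d) (transpositions d).
         \<phi> (fs_mult (sym_group d) (transpositions d) s t) = fs_mult (sym_group d) C (\<phi> s) (\<phi> t)) \<and>
      (\<forall>s \<in> full_fact_semigroup (sym_group d) (transpositions d).
         fs_prod (sym_group d) (\<phi> s) = fs_prod (sym_group d) s) \<and>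
      (\<forall>g \<in> carrier (sym_group d). \<forall>s \<in> full_fact_semigroup (sym_group d) (transpositions d).
         \<phi> (fs_act (sym_group d) (transpositions d) g s) = fs_act (sym_group d) C g (\<phi> s))"
proof -
  let ?G = "sym_group d"
  interpret symmetric_group d .
  interpret C: conj_invariant ?G C
    unfolding assms(3) by (rule conj_invariant_conj_class[OF assms(1)])
  define \<tau> where "\<tau> = Transposition.transpose i\<^sub>1 i\<^sub>2"
  have \<tau>: "\<tau> \<in> carrier ?G" unfolding \<tau>_def using assms(4,5) by (rule transpose_carrier)
  have \<tau>2: "\<tau> \<otimes>\<^bsub>?G\<^esub> \<tau> = \<one>\<^bsub>?G\<^esub>" by (simp add: \<tau>_def sym_group_mult sym_group_one)
  have fin: "finite (carrier ?G)" by (simp add: sym_group_def finite_permutations)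
  obtain i\<^sub>3 i\<^sub>4 where i34: "i\<^sub>3 \<in> {1..d} - {i\<^sub>1, i\<^sub>2}" "i\<^sub>4 \<in> {1..d} - {i\<^sub>1, i\<^sub>2}" "i\<^sub>3 \<noteq> i\<^sub>4"
    and act: "fs_act ?G C (Transposition.transpose i\<^sub>3 i\<^sub>4) sbar = sbar"
    using assms(9) by blast
  obtain w where w: "w \<in> fs_words C" "sbar = fs_rel ?G C `` {w}"
    using assms(7) unfolding fact_semigroup_def quotient_def by blast
  then have prod_w: "C.word_prod w = \<tau>" using assms(8) by (simp add: \<tau>_def C.fs_prod_class)
  define \<tau>' where "\<tau>' = Transposition.transpose i\<^sub>3 i\<^sub>4"
  have "\<tau>' \<in> carrier ?G" unfolding \<tau>'_def using i34 by (intro transpose_carrier) auto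
  then have fixed_w: "C.heq (C.conj_word \<tau>' w) w"
    using act w C.class_eqD[of _ w] by (simp add: \<tau>'_def C.fs_act_class C.heq_def)
  obtain W where W: "W \<in> fs_words C" "C.word_prod W = \<tau>" "C.heq (C.conj_word \<tau> W) W"
    and W_fixed: "\<And>a g h. \<lbrakk>a \<in> carrier ?G; conj_elt ?G a \<tau> = \<tau>; g \<in> carrier ?G;
        h = conj_elt ?G g \<tau>; C.heq (C.conj_word h w) w\<rbrakk>
      \<Longrightarrow> C.heq (C.conj_word (conj_elt ?G a h) W) W"
    using C.stabilized_word[OF fin w(1)] \<tau>2 unfolding prod_w by blast
  have Wl: "W \<in> lists C" using W(1) by (simp add: fs_words_def)
  have centralizer: "C.heq (C.conj_word h W) W"
    if h: "h \<in> carrier ?G" "conj_elt ?G h \<tau> = \<tau>" for h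
    using h(1) h(2)[unfolded \<tau>_def] assms(4-6)
  proof (rule transposition_centralizer_induct[where P = "\<lambda>h. C.heq (C.conj_word h W) W"])
    show "C.heq (C.conj_word id W) W"
      using C.conj_word_one[OF Wl] C.heq_refl[OF Wl] by (simp add: sym_group_one)
    show "C.heq (C.conj_word (Transposition.transpose i\<^sub>1 i\<^sub>2) W) W" using W(3) by (simp add: \<tau>_def)
  next
    \<comment> \<open>A disjoint \<open>(k l)\<close> is conjugate to \<open>(i\<^sub>3 i\<^sub>4)\<close> inside the centralizer of \<open>(i\<^sub>1 i\<^sub>2)\<close>, so the
      symmetry of \<open>w\<close> under \<open>(i\<^sub>3 i\<^sub>4)\<close> is inherited by \<open>W\<close>.\<close>
    fix k l assume kl: "k \<in> {1..d} - {i\<^sub>1, i\<^sub>2}" "l \<in> {1..d} - {i\<^sub>1, i\<^sub>2}" "k \<noteq> l"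
    obtain a where a: "a permutes {1..d} - {i\<^sub>1, i\<^sub>2}" "a i\<^sub>3 = k" "a i\<^sub>4 = l"
      using permutation_two_points[OF i34 kl] .
    have "a permutes {1..d}" using a(1) by (rule permutes_subset) blast
    then have ac: "a \<in> carrier ?G" by (simp add: sym_group_carrier)
    have "a i\<^sub>1 = i\<^sub>1" "a i\<^sub>2 = i\<^sub>2" using a(1) by (simp_all add: permutes_not_in)
    then have "conj_elt ?G a \<tau> = \<tau>" using ac by (simp add: \<tau>_def conj_elt_transpose)
    moreover have "conj_elt ?G a \<tau>' = Transposition.transpose k l"
      using ac a by (simp add: \<tau>'_def conj_elt_transpose)
    moreover obtain g where "g permutes {1..d}" "g i\<^sub>1 = i\<^sub>3" "g i\<^sub>2 = i\<^sub>4"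
      using permutation_two_points[OF assms(4-6), of i\<^sub>3 i\<^sub>4] i34 by blast
    then have "g \<in> carrier ?G" "\<tau>' = conj_elt ?G g \<tau>"
      by (simp_all add: sym_group_carrier \<tau>_def \<tau>'_def conj_elt_transpose)
    ultimately show "C.heq (C.conj_word (Transposition.transpose k l) W) W"
      using W_fixed[OF ac] fixed_w by metis
  next
    fix p q assume "p \<in> carrier ?G" "q \<in> carrier ?G"
      "C.heq (C.conj_word p W) W" "C.heq (C.conj_word q W) W"
    then show "C.heq (C.conj_word (p \<circ> q) W) W"
      using C.conj_word_fixed_mult[OF _ _ Wl] by (simp add: sym_group_mult)
  qed
  interpret letter_substitution ?G C "transpositions d" \<tau> W
    using transpositions_conj_class[OF assms(4-6)] one_notin_transpositions W(1,2) centralizer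
    by unfold_locales (simp_all add: \<tau>_def)
  have one_notin_C: "\<one>\<^bsub>?G\<^esub> \<notin> C"
  proof
    assume "\<one>\<^bsub>?G\<^esub> \<in> C"
    then have "\<sigma> = id"
      using one_in_conj_class[OF assms(1)] by (simp add: assms(3) sym_group_one)
    then show False using assms(2) evenperm_id by simp
  qed
  have "inj_on subst_class (full_fact_semigroup ?G (transpositions d))"
  proof (rule inj_on_subst_class[OF one_notin_C])
    fix u v
    assume u: "u \<in> fs_words (transpositions d)" "generate ?G (set u) = carrier ?G"
      and v: "v \<in> fs_words (transpositions d)" "generate ?G (set v) = carrier ?G"
      and eq: "C.word_prod u = C.word_prod v" "length u = length v"
    have l: "u \<in> lists (transpositions d)" "v \<in> lists (transpositions d)" "u \<noteq> []"
      using u v by (auto simp: fs_words_def)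
    have "heq u v"
      by (rule transposition_words_equivalent[OF subset_refl l(1,2)[unfolded transpositions_eq]
            connected_generate[OF l(1) u(2)] connected_generate[OF l(2) v(2)] eq])
    then show "fs_cong ?G (transpositions d) u v" using l by (intro heq_nonempty) auto
  qed
  then show ?thesis
    using subst_class_in subst_class_mult subst_class_prod subst_class_act
    by (intro exI[of _ subst_class]) auto
qed

end
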